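(* Let $k\ge 3$ and let $\mathcal{G}$ be a $k$-uniform unicyclic hypergraph of order $n$ and girth $g$. Then $\rho(\mathcal{G})\le\rho(\mathscr{U}^{\ast}(n,k,g))$, with equality if and only if $\mathcal{G}\cong\mathscr{U}^{\ast}(n,k,g)$.
   Context: A hypergraph $\mathcal{G}=(V,E)$ consists of a finite nonempty vertex set $V$ and a set $E$ of edges, each edge being a subset of $V$ with at least two elements (edges are pairwise distinct, undirected). Its order is $|V|$. It is $k$-uniform if every edge has exactly $k$ elements. Isomorphism $\cong$ means a bijection of vertex sets that induces a bijection of edge sets. Adjacency matrix: $\mathcal{A}_{\mathcal{G}}$ is the real symmetric matrix indexed by $V$ with $(\mathcal{A}_{\mathcal{G}})_{ij}=\sum_{e\in E,\ i,j\in e}\frac{1}{|e|-1}$ for $i\ne j$, and zero diagonal. The spectral radius $\rho(\mathcal{G})$ is the maximum modulus of the eigenvalues of $\mathcal{A}_{\mathcal{G}}$. A hyperpath of length $q$ is an alternating sequence $v_1e_1v_2e_2\cdots v_qe_qv_{q+1}$ of distinct vertices and distinct edges with $v_i,v_{i+1}\in e_i$, $e_i\cap e_{i+1}=\{v_{i+1}\}$, and $e_i\cap e_j=\emptyset$ if $|i-j|\ge 2$. A hypergraph is connected if any two vertices are joined by a hyperpath. A hypercycle of length $q\ge 3$ is a sequence $v_1e_1v_2\cdots v_qe_qv_1$ obtained from a hyperpath $v_1e_1\cdots e_{q-1}v_q$ by adding a new edge $e_q$ with $e_q\cap e_1=\{v_1\}$, $e_q\cap e_{q-1}=\{v_q\}$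 and $e_q\cap e_j=\emptyset$ for the other $j$; a hypercycle of length 2 consists of two distinct edges whose intersection is exactly two vertices $\{v_1,v_2\}$. The girth is the length of a shortest hypercycle. A connected $k$-uniform hypergraph with $n$ vertices and $m$ edges is unicyclic if $n-1=(k-1)m-1$, i.e. $n=(k-1)m$; such a hypergraph contains exactly one hypercycle. For $g\ge 2$, $\mathcal{C}_g$ denotes the $k$-uniform $g$-hypercycle $v_1e_1v_2e_2\cdots v_ge_gv_1$ with $e_i=\{v_i,v_{a(i,1)},\dots,v_{a(i,k-2)},v_{i+1}\}$ for $1\le i\le g$ (where $v_{g+1}:=v_1$), all the vertices $v_i$ and $v_{a(i,j)}$ being distinct. $\mathscr{U}^{\ast}(n,k,g)$ is the $k$-uniform unicyclic hypergraph of order $n$ obtained by attaching $\frac{n}{k-1}-g$ pendant edges at the vertex $v_1$ of $\mathcal{C}_g$ (each pendant edge consists of $v_1$ and $k-1$ new vertices of degree one). *)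

theory Defs
  imports "Jordan_Normal_Form.Spectral_Radius" "HOL-Library.Extended_Nat"
begin

record 'a hypergraph =
  verts :: "'a set"
  edges :: "'a set set"

definition is_hypergraph :: "'a hypergraph \<Rightarrow> bool" where
  "is_hypergraph G \<longleftrightarrow> finite (verts G) \<and> verts G \<noteq> {} \<and>
     (\<forall>e\<in>edges G. e \<subseteq> verts G \<and> 2 \<le> card e)"

definition uniform :: "nat \<Rightarrow> 'a hypergraph \<Rightarrow> bool" where
  "uniform k G \<longleftrightarrow> (\<forall>e\<in>edges G. card e = k)"

definition hypergraph_iso :: "'a hypergraph \<Rightarrow> 'b hypergraph \<Rightarrow> bool" (infix "\<cong>\<^sub>H" 50) where
  "G \<cong>\<^sub>H H \<longleftrightarrow>
     (\<exists>f. bij_betw f (verts G) (verts H) \<and> bij_betw (\<lambda>e. f ` e) (edges G) (edges H))"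


subsection \<open>Adjacency matrix and spectral radius\<close>

definition adj :: "'a hypergraph \<Rightarrow> 'a \<Rightarrow> 'a \<Rightarrow> real" where
  "adj G i j =
     (if i = j then 0 else \<Sum>e\<in>{e\<in>edges G. i \<in> e \<and> j \<in> e}. 1 / (real (card e) - 1))"

text \<open>The library's matrices are indexed by initial segments of the natural numbers, so the
  vertices are enumerated in an arbitrary order. The eigenvalues do not depend on that choice,
  see the lemma \<open>eigenvalue_adjacency_matrix\<close> below.\<close>

definition vert_enum :: "'a hypergraph \<Rightarrow> nat \<Rightarrow> 'a" where
  "vert_enum G = (SOME f. bij_betw f {0..<card (verts G)} (verts G))"

definition adjacency_matrix :: "'a hypergraph \<Rightarrow> real mat" where
  "adjacency_matrix G =
     mat (card (verts G)) (card (verts G)) (\<lambda>(i, j). adj G (vert_enum G i) (vert_enum G j))"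

definition hypergraph_spectral_radius :: "'a hypergraph \<Rightarrow> real" ("\<rho>") where
  "\<rho> G = spectral_radius (map_mat complex_of_real (adjacency_matrix G))"

lemma bij_betw_vert_enum:
  assumes "finite (verts G)"
  shows "bij_betw (vert_enum G) {0..<card (verts G)} (verts G)"
  unfolding vert_enum_def using ex_bij_betw_nat_finite[OF assms] by (rule someI_ex)

lemma eigenvalue_adjacency_matrix:
  fixes G :: "'a hypergraph"
  assumes fin: "finite (verts G)"
  shows "eigenvalue (map_mat complex_of_real (adjacency_matrix G)) c \<longleftrightarrow>
    (\<exists>x :: 'a \<Rightarrow> complex. (\<exists>i\<in>verts G. x i \<noteq> 0) \<and>
       (\<forall>i\<in>verts G. (\<Sum>j\<in>verts G. complex_of_real (adj G i j) * x j) = c * x i))"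
proof -
  let ?n = "card (verts G)" and ?f = "vert_enum G"
  let ?A = "map_mat complex_of_real (adjacency_matrix G)"
  note bij = bij_betw_vert_enum[OF fin]
  have mem: "?f i \<in> verts G" if "i < ?n" for i
    using bij_betw_apply[OF bij] that by simp
  have enum: "\<exists>i<?n. a = ?f i" if "a \<in> verts G" for a
    using bij that unfolding bij_betw_def by fastforce
  have dim: "dim_row ?A = ?n" by (simp add: adjacency_matrix_def)
  have row: "(?A *\<^sub>v v) $ i = (\<Sum>j\<in>{0..<?n}. complex_of_real (adj G (?f i) (?f j)) * v $ j)"
    if "v \<in> carrier_vec ?n" "i < ?n" for v i
    using that by (auto simp: adjacency_matrix_def scalar_prod_def intro!: sum.cong)
  have reidx: "(\<Sum>j\<in>verts G. h j) = (\<Sum>j\<in>{0..<?n}. h (?f j))" for h :: "'a \<Rightarrow> complex"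
    using sum.reindex_bij_betw[OF bij, of h] by simp
  show ?thesis
  proof
    assume "eigenvalue ?A c"
    then obtain v where v: "v \<in> carrier_vec ?n" "v \<noteq> 0\<^sub>v ?n" "?A *\<^sub>v v = c \<cdot>\<^sub>v v"
      unfolding eigenvalue_def eigenvector_def dim by blast
    define x where "x a = v $ (inv_into {0..<?n} ?f a)" for a
    have xf: "x (?f i) = v $ i" if "i < ?n" for i
      using bij that by (simp add: x_def bij_betw_def inv_into_f_f)
    obtain i where i: "i < ?n" "v $ i \<noteq> 0" using v(1,2) by (auto simp: vec_eq_iff)
    have "?f i \<in> verts G" using i mem by blast
    moreover have "x (?f i) \<noteq> 0" using i xf by simp
    ultimately have "\<exists>a\<in>verts G. x a \<noteq> 0" by blast
    moreover have "(\<Sum>b\<in>verts G. complex_of_real (adj G a b) * x b) = c * x a"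
      if a: "a \<in> verts G" for a
    proof -
      obtain i where i: "i < ?n" "a = ?f i" using enum[OF a] by blast
      have "(\<Sum>b\<in>verts G. complex_of_real (adj G a b) * x b) = (?A *\<^sub>v v) $ i"
        unfolding reidx row[OF v(1) i(1)] using i xf by (auto intro!: sum.cong)
      also have "\<dots> = c * x a" using v i xf by simp
      finally show ?thesis .
    qed
    ultimately show "\<exists>x :: 'a \<Rightarrow> complex. (\<exists>i\<in>verts G. x i \<noteq> 0) \<and>
       (\<forall>i\<in>verts G. (\<Sum>j\<in>verts G. complex_of_real (adj G i j) * x j) = c * x i)" by blast
  next
    assume "\<exists>x :: 'a \<Rightarrow> complex. (\<exists>i\<in>verts G. x i \<noteq> 0) \<and>
       (\<forall>i\<in>verts G. (\<Sum>j\<in>verts G. complex_of_real (adj G i j) * x j) = c * x i)"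
    then obtain x :: "'a \<Rightarrow> complex" where nz: "\<exists>i\<in>verts G. x i \<noteq> 0"
      and ev: "\<And>i. i \<in> verts G \<Longrightarrow>
        (\<Sum>j\<in>verts G. complex_of_real (adj G i j) * x j) = c * x i" by blast
    define v where "v = vec ?n (\<lambda>i. x (?f i))"
    have v: "v \<in> carrier_vec ?n" by (simp add: v_def)
    obtain i where "i < ?n" "x (?f i) \<noteq> 0" using nz enum by blast
    then have "v \<noteq> 0\<^sub>v ?n" by (auto simp: v_def vec_eq_iff)
    moreover have "?A *\<^sub>v v = c \<cdot>\<^sub>v v"
    proof (rule eq_vecI)
      fix i assume "i < dim_vec (c \<cdot>\<^sub>v v)"
      then have i: "i < ?n" using v by simp
      have "?f i \<in> verts G" using i mem by blast
      then show "(?A *\<^sub>v v) $ i = (c \<cdot>\<^sub>v v) $ i"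
        unfolding row[OF v i] using ev[of "?f i"] i by (simp add: reidx v_def)
    qed (use v dim in auto)
    ultimately show "eigenvalue ?A c"
      unfolding eigenvalue_def eigenvector_def dim using v by blast
  qed
qed


subsection \<open>Hyperpaths, connectedness, hypercycles, girth\<close>

text \<open>A path \<open>v\<^sub>1 e\<^sub>1 v\<^sub>2 \<dots> v\<^sub>q e\<^sub>q v\<^sub>q\<^sub>+\<^sub>1\<close> is given by the list \<open>vs\<close> of its \<open>q + 1\<close> vertices
  and the list \<open>es\<close> of its \<open>q\<close> edges; list positions start at 0.\<close>

definition path :: "'a hypergraph \<Rightarrow> 'a list \<Rightarrow> 'a set list \<Rightarrow> bool" where
  "path G vs es \<longleftrightarrow>
     length vs = length es + 1 \<and> es \<noteq> [] \<and>
     distinct vs \<and> set vs \<subseteq> verts G \<and> distinct es \<and> set es \<subseteq> edges G \<and>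
     (\<forall>i<length es. vs ! i \<in> es ! i \<and> vs ! (i + 1) \<in> es ! i)"

definition hyperpath :: "'a hypergraph \<Rightarrow> 'a list \<Rightarrow> 'a set list \<Rightarrow> bool" where
  "hyperpath G vs es \<longleftrightarrow> path G vs es \<and>
     (\<forall>i. i + 1 < length es \<longrightarrow> es ! i \<inter> es ! (i + 1) = {vs ! (i + 1)}) \<and>
     (\<forall>i j. i + 2 \<le> j \<and> j < length es \<longrightarrow> es ! i \<inter> es ! j = {})"

text \<open>Connectedness asks for a path of distinct vertices and edges, without the condition that
  consecutive edges meet in one vertex only. With that condition, the two edges of a hypercycle of
  length 2 would not be joined to each other, and no uniform hypergraph of girth 2 with edges of
  size at least 3 could be unicyclic, not even that hypercycle itself. Hypergraphs all of whose
  vertices are joined by hyperpaths are covered, see \<open>hyperpath_imp_connected\<close>.\<close>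

definition connected_hypergraph :: "'a hypergraph \<Rightarrow> bool" where
  "connected_hypergraph G \<longleftrightarrow>
     (\<forall>u\<in>verts G. \<forall>w\<in>verts G. u \<noteq> w \<longrightarrow>
        (\<exists>vs es. path G vs es \<and> hd vs = u \<and> last vs = w))"

lemma hyperpath_imp_connected:
  assumes "\<And>u w. u \<in> verts G \<Longrightarrow> w \<in> verts G \<Longrightarrow> u \<noteq> w \<Longrightarrow>
    \<exists>vs es. hyperpath G vs es \<and> hd vs = u \<and> last vs = w"
  shows "connected_hypergraph G"
  using assms unfolding connected_hypergraph_def hyperpath_def by blast

text \<open>For \<open>q \<ge> 3\<close>, \<open>vs\<close> and \<open>es\<close> are the vertices \<open>v\<^sub>1, \<dots>, v\<^sub>q\<close> and edges
  \<open>e\<^sub>1, \<dots>, e\<^sub>q\<^sub>-\<^sub>1\<close> of the hyperpath, and \<open>e\<close> is the closing edge \<open>e\<^sub>q\<close>.\<close>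

definition has_hypercycle :: "'a hypergraph \<Rightarrow> nat \<Rightarrow> bool" where
  "has_hypercycle G q \<longleftrightarrow>
     (q = 2 \<and> (\<exists>e1\<in>edges G. \<exists>e2\<in>edges G. e1 \<noteq> e2 \<and>
        (\<exists>v1 v2. v1 \<noteq> v2 \<and> e1 \<inter> e2 = {v1, v2}))) \<or>
     (3 \<le> q \<and> (\<exists>vs es e. hyperpath G vs es \<and> length vs = q \<and>
        e \<in> edges G \<and> e \<notin> set es \<and>
        e \<inter> hd es = {hd vs} \<and> e \<inter> last es = {last vs} \<and>
        (\<forall>j. 0 < j \<and> j + 1 < length es \<longrightarrow> e \<inter> es ! j = {})))"

text \<open>The girth is \<open>\<infinity>\<close> if there is no hypercycle.\<close>

definition girth :: "'a hypergraph \<Rightarrow> enat" where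
  "girth G = (INF q\<in>{q. has_hypercycle G q}. enat q)"

definition unicyclic :: "nat \<Rightarrow> 'a hypergraph \<Rightarrow> bool" where
  "unicyclic k G \<longleftrightarrow> is_hypergraph G \<and> uniform k G \<and> connected_hypergraph G \<and>
     card (verts G) = (k - 1) * card (edges G)"


subsection \<open>The extremal hypergraph\<close>

text \<open>\<open>Cyc i\<close> is the cycle vertex \<open>v\<^sub>i\<^sub>+\<^sub>1\<close>, \<open>Inner i j\<close> is the vertex
  \<open>v\<^bsub>a(i+1,j+1)\<^esub>\<close> of degree one on the cycle edge \<open>e\<^sub>i\<^sub>+\<^sub>1\<close>, and \<open>Pend i j\<close> is the
  \<open>j\<close>-th new vertex of the \<open>i\<close>-th pendant edge.\<close>

datatype cvertex = Cyc nat | Inner nat nat | Pend nat nat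

definition hypercycle_graph :: "nat \<Rightarrow> nat \<Rightarrow> cvertex hypergraph" where
  "hypercycle_graph k g =
     \<lparr>verts = {Cyc i |i. i < g} \<union> {Inner i j |i j. i < g \<and> j < k - 2},
      edges = {{Cyc i, Cyc ((i + 1) mod g)} \<union> {Inner i j |j. j < k - 2} |i. i < g}\<rparr>"

definition U_star :: "nat \<Rightarrow> nat \<Rightarrow> nat \<Rightarrow> cvertex hypergraph" where
  "U_star n k g =
     (let p = n div (k - 1) - g in
      \<lparr>verts = verts (hypercycle_graph k g) \<union> {Pend i j |i j. i < p \<and> j < k - 1},
       edges = edges (hypercycle_graph k g) \<union> {{Cyc 0} \<union> {Pend i j |j. j < k - 1} |i. i < p}\<rparr>)"

end

theory Submission
  imports Defs "HOL-Analysis.Function_Topology"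
begin

text \<open>
  The adjacency matrix is symmetric and nonnegative, so \<open>\<rho> G\<close> is the maximum of its Rayleigh
  quotient, and for connected \<open>G\<close> it is attained at a positive eigenvector \<open>x\<close>
  (\<open>spectral_radius_rayleigh\<close>, \<open>perron_vector\<close>). Let \<open>w\<close> be a vertex at which \<open>x\<close> is largest.
  If in some edges that avoid \<open>w\<close> one vertex is replaced by \<open>w\<close>, the value of the quadratic form
  at \<open>x\<close> cannot drop, hence neither can the spectral radius. If the spectral radius stays the same,
  \<open>x\<close> is an eigenvector for the same eigenvalue after the replacement too; but every replaced edge
  strictly increases the row of \<open>w\<close>, so no edge was replaced (\<open>edge_shift_spectral_radius\<close>).

  It remains to see that such replacements lead from \<open>G\<close> to the extremal hypergraph in one go
  (\<open>concentrate_at_vertex\<close>). Fix a hypercycle of length \<open>g\<close> and regard its \<open>g (k - 1)\<close> vertices as a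
  single large edge. Together with the other edges this family is connected, and unicyclicity says
  exactly that it has the size of a tree: the numbers \<open>card e - 1\<close> add up to \<open>n - 1\<close>. Let \<open>p e\<close> be a
  vertex of \<open>e\<close> nearest to \<open>w\<close>. The sets \<open>e - {p e}\<close> cover all vertices but \<open>w\<close>, so by this count
  they partition them (\<open>rooted_edge_partition\<close>). Replacing \<open>p e\<close> by \<open>w\<close> turns every edge outside
  the hypercycle into a pendant edge at \<open>w\<close>.

  On the hypercycle let \<open>r\<close> be the vertex nearest to \<open>w\<close>. If two cycle edges meet in \<open>r\<close>, then \<open>r\<close>
  is replaced by \<open>w\<close> in both. If \<open>r\<close> lies on one cycle edge only, it is replaced by \<open>w\<close> there, and
  in a neighbouring cycle edge a vertex shared with that edge is replaced by \<open>w\<close>, so that \<open>w\<close>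
  becomes the common vertex while the old one stays behind on the first edge
  (\<open>loose_cycle_shift\<close>). In both cases the result is a hypercycle of length \<open>g\<close> through \<open>w\<close>, two of
  whose edges meet in \<open>w\<close>, with all other edges pendant at \<open>w\<close>.
\<close>

section \<open>Rayleigh quotients of symmetric forms\<close>

definition quad_form :: "'a set \<Rightarrow> ('a \<Rightarrow> 'a \<Rightarrow> real) \<Rightarrow> ('a \<Rightarrow> real) \<Rightarrow> real" where
  "quad_form V A y = (\<Sum>i\<in>V. y i * (\<Sum>j\<in>V. A i j * y j))"

lemma quad_form_scale: "quad_form V A (\<lambda>i. c * y i) = c\<^sup>2 * quad_form V A y"
  unfolding quad_form_def sum_distrib_left
  by (intro sum.cong refl) (simp add: power2_eq_square sum_distrib_left algebra_simps)

lemma quad_form_add: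
  assumes sym: "\<And>i j. A i j = A j i"
  shows "quad_form V A (\<lambda>i. x i + t * h i) =
    quad_form V A x + 2 * t * (\<Sum>i\<in>V. h i * (\<Sum>j\<in>V. A i j * x j)) + t\<^sup>2 * quad_form V A h"
proof -
  have swap: "(\<Sum>i\<in>V. x i * (\<Sum>j\<in>V. A i j * h j)) = (\<Sum>i\<in>V. h i * (\<Sum>j\<in>V. A i j * x j))"
    unfolding sum_distrib_left
    by (subst sum.swap) (intro sum.cong refl, simp add: sym algebra_simps)
  define u where "u i = (\<Sum>j\<in>V. A i j * x j)" for i
  define v where "v i = (\<Sum>j\<in>V. A i j * h j)" for i
  have lin: "(\<Sum>j\<in>V. A i j * (x j + t * h j)) = u i + t * v i" for i
    by (simp add: u_def v_def sum_distrib_left sum.distrib algebra_simps)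
  have "quad_form V A (\<lambda>i. x i + t * h i) =
     (\<Sum>i\<in>V. x i * u i + t * (x i * v i) + t * (h i * u i) + t\<^sup>2 * (h i * v i))"
    unfolding quad_form_def lin
    by (intro sum.cong refl) (simp add: algebra_simps power2_eq_square)
  also have "\<dots> = quad_form V A x + t * (\<Sum>i\<in>V. x i * v i)
       + t * (\<Sum>i\<in>V. h i * u i) + t\<^sup>2 * quad_form V A h"
    by (simp add: sum.distrib sum_distrib_left quad_form_def u_def v_def)
  finally show ?thesis using swap by (simp add: u_def v_def)
qed

text \<open>The unit sphere of the functions supported on \<open>V\<close> is a closed subset of a product of compact
  intervals, so it is compact for pointwise convergence by Tychonoff's theorem; the quadratic form
  is continuous and attains its maximum there. Homogeneity extends the bound to all functions.\<close>

lemma rayleigh_maximizer_exists: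
  fixes A :: "'a \<Rightarrow> 'a \<Rightarrow> real"
  assumes fin: "finite V" and ne: "V \<noteq> {}"
  obtains x where "(\<Sum>i\<in>V. (x i)\<^sup>2) = 1"
    and "\<And>y. quad_form V A y \<le> quad_form V A x * (\<Sum>i\<in>V. (y i)\<^sup>2)"
proof -
  \<comment> \<open>Outside \<open>V\<close> the coordinates are pinned to 0, so that also these factors are compact.\<close>
  define box where "box = (PiE UNIV (\<lambda>i. if i \<in> V then {-1..1::real} else {0}))"
  define S where "S = box \<inter> {f. (\<Sum>i\<in>V. (f i)\<^sup>2) = 1}"
  have "compactin (product_topology (\<lambda>_. euclidean) UNIV) box"
    unfolding box_def by (subst compactin_PiE) auto
  then have "compact box" by (simp add: euclidean_product_topology)
  moreover have "closed {f :: 'a \<Rightarrow> real. (\<Sum>i\<in>V. (f i)\<^sup>2) = 1}"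
    by (intro closed_Collect_eq continuous_intros continuous_on_product_coordinates)
  ultimately have comp: "compact S" unfolding S_def by blast
  obtain v where v: "v \<in> V" using ne by blast
  have "(\<lambda>i. if i = v then 1 else 0) \<in> S"
  proof -
    have "(\<Sum>i\<in>V. (if i = v then 1 else 0 :: real)\<^sup>2) = (\<Sum>i\<in>V. if i = v then 1 else 0)"
      by (intro sum.cong) auto
    then show ?thesis using v fin by (auto simp: S_def box_def)
  qed
  then have neS: "S \<noteq> {}" by blast
  have cont: "continuous_on S (quad_form V A)"
    unfolding quad_form_def
    by (intro continuous_intros continuous_on_subset[OF continuous_on_product_coordinates]) auto
  obtain x where x: "x \<in> S" and mx: "\<And>y. y \<in> S \<Longrightarrow> quad_form V A y \<le> quad_form V A x"
    using continuous_attains_sup[OF comp neS cont] by blast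
  have "quad_form V A y \<le> quad_form V A x * (\<Sum>i\<in>V. (y i)\<^sup>2)" for y
  proof (cases "(\<Sum>i\<in>V. (y i)\<^sup>2) = 0")
    case True
    then have "y i = 0" if "i \<in> V" for i
      using that fin by (simp add: sum_nonneg_eq_0_iff)
    then have "quad_form V A y = 0" by (simp add: quad_form_def)
    then show ?thesis using True by simp
  next
    case False
    define s where "s = (\<Sum>i\<in>V. (y i)\<^sup>2)"
    have s: "s > 0" using False unfolding s_def by (simp add: sum_nonneg less_le)
    define z where "z i = (if i \<in> V then 1 / sqrt s * y i else 0)" for i
    have z2: "(\<Sum>i\<in>V. (z i)\<^sup>2) = 1"
    proof -
      have "(\<Sum>i\<in>V. (z i)\<^sup>2) = (\<Sum>i\<in>V. (y i)\<^sup>2 / s)"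
        by (intro sum.cong refl) (use s in \<open>simp add: z_def power_divide\<close>)
      also have "\<dots> = s / s" unfolding s_def by (rule sum_divide_distrib[symmetric])
      finally show ?thesis using s by simp
    qed
    have "z i \<in> {-1..1}" if "i \<in> V" for i
    proof -
      have "(z i)\<^sup>2 \<le> 1" using member_le_sum[of i V "\<lambda>i. (z i)\<^sup>2"] that fin z2 by simp
      then show ?thesis by (simp add: abs_square_le_1 abs_le_iff)
    qed
    then have "z \<in> S" using z2 by (auto simp: S_def box_def z_def)
    from mx[OF this] have "quad_form V A (\<lambda>i. 1 / sqrt s * y i) \<le> quad_form V A x"
      by (simp add: quad_form_def z_def)
    then have "quad_form V A y / s \<le> quad_form V A x"
      unfolding quad_form_scale using s by (simp add: power_divide)
    then show ?thesis using s by (simp add: field_simps s_def)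
  qed
  then show ?thesis using that x by (auto simp: S_def)
qed

text \<open>First order condition: the defect \<open>h\<close> of the eigenvalue equation is half the gradient of
  \<open>quad_form V A y - M * (\<Sum>i\<in>V. (y i)\<^sup>2)\<close> at the maximum point \<open>x\<close>. Moving from \<open>x\<close> by \<open>t\<close> in
  direction \<open>h\<close> changes this expression by \<open>2 * t * D + t\<^sup>2 * C\<close> with \<open>D\<close> the square norm of \<open>h\<close>,
  which would be positive for small \<open>t > 0\<close> if \<open>h \<noteq> 0\<close>.\<close>

lemma rayleigh_maximizer_eigenvector:
  assumes fin: "finite V" and sym: "\<And>i j. A i j = A j i"
    and le: "\<And>y. quad_form V A y \<le> M * (\<Sum>i\<in>V. (y i)\<^sup>2)"
    and eq: "quad_form V A x = M * (\<Sum>i\<in>V. (x i)\<^sup>2)"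
    and i: "i \<in> V"
  shows "(\<Sum>j\<in>V. A i j * x j) = M * x i"
proof -
  define u where "u i = (\<Sum>j\<in>V. A i j * x j)" for i
  define h where "h i = u i - M * x i" for i
  define D where "D = (\<Sum>i\<in>V. (h i)\<^sup>2)"
  define C where "C = quad_form V A h - M * D"
  have "D = (\<Sum>i\<in>V. h i * u i - M * (h i * x i))"
    unfolding D_def by (intro sum.cong refl) (simp add: h_def algebra_simps power2_eq_square)
  then have D: "D = (\<Sum>i\<in>V. h i * u i) - M * (\<Sum>i\<in>V. h i * x i)"
    by (simp add: sum_subtractf sum_distrib_left)
  have key: "2 * t * D + t\<^sup>2 * C \<le> 0" for t
  proof -
    have "(\<Sum>i\<in>V. (x i + t * h i)\<^sup>2) = (\<Sum>i\<in>V. (x i)\<^sup>2 + 2 * t * (h i * x i) + t\<^sup>2 * (h i)\<^sup>2)"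
      by (intro sum.cong refl) (simp add: power2_eq_square algebra_simps)
    then have sq: "(\<Sum>i\<in>V. (x i + t * h i)\<^sup>2) =
        (\<Sum>i\<in>V. (x i)\<^sup>2) + 2 * t * (\<Sum>i\<in>V. h i * x i) + t\<^sup>2 * D"
      unfolding D_def by (simp add: sum.distrib sum_distrib_left)
    have "2 * t * D + t\<^sup>2 * C =
        quad_form V A (\<lambda>i. x i + t * h i) - M * (\<Sum>i\<in>V. (x i + t * h i)\<^sup>2)"
      unfolding quad_form_add[of A, OF sym] sq eq C_def u_def[symmetric]
      by (subst D) (simp add: algebra_simps)
    then show ?thesis using le by simp
  qed
  have "D \<le> 0"
  proof (rule ccontr)
    assume "\<not> D \<le> 0"
    then have pos: "D > 0" by simp
    define t where "t = D / (\<bar>C\<bar> + 1)"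
    have t: "t > 0" using pos by (simp add: t_def)
    have "\<bar>t * C\<bar> \<le> D" using pos by (simp add: t_def abs_mult field_simps)
    then have "t * (2 * D + t * C) > 0" using t pos by (intro mult_pos_pos) auto
    then show False using key[of t] by (simp add: power2_eq_square algebra_simps)
  qed
  then have "D = 0" unfolding D_def by (intro antisym sum_nonneg) auto
  then have "h i = 0" using i fin by (simp add: D_def sum_nonneg_eq_0_iff)
  then show ?thesis by (simp add: h_def u_def)
qed

section \<open>Spectral radius and Perron vector\<close>

lemma adj_sym: "adj G i j = adj G j i"
  by (simp add: adj_def conj_commute)

lemma adj_nonneg:
  assumes "is_hypergraph G"
  shows "0 \<le> adj G i j"
proof -
  have "2 \<le> card e" if "e \<in> edges G" for e using assms that by (auto simp: is_hypergraph_def)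
  then show ?thesis by (fastforce simp: adj_def intro!: sum_nonneg)
qed

lemma finite_edges: "is_hypergraph G \<Longrightarrow> finite (edges G)"
  unfolding is_hypergraph_def by (meson finite_Pow_iff finite_subset PowI subsetI)

lemma spectral_radius_eigenvalue:
  assumes "is_hypergraph G"
  shows "\<exists>c. cmod c = \<rho> G \<and> eigenvalue (map_mat complex_of_real (adjacency_matrix G)) c"
    and "eigenvalue (map_mat complex_of_real (adjacency_matrix G)) c \<Longrightarrow> cmod c \<le> \<rho> G"
proof -
  let ?A = "map_mat complex_of_real (adjacency_matrix G)"
  have A: "?A \<in> carrier_mat (card (verts G)) (card (verts G))"
    by (simp add: adjacency_matrix_def)
  have n: "0 < card (verts G)" using assms by (simp add: is_hypergraph_def card_gt_0_iff)
  show "\<exists>c. cmod c = \<rho> G \<and> eigenvalue ?A c"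
    using spectral_radius_mem_max(1)[OF A n]
    by (auto simp: hypergraph_spectral_radius_def spectrum_def)
  show "cmod c \<le> \<rho> G" if "eigenvalue ?A c"
    unfolding hypergraph_spectral_radius_def
    by (rule spectral_radius_mem_max(2)[OF A n]) (use that in \<open>auto simp: spectrum_def\<close>)
qed

text \<open>Let \<open>M\<close> be the maximum of the Rayleigh quotient. It is an eigenvalue, so \<open>M \<le> \<rho> G\<close>. Conversely,
  if \<open>z\<close> is a complex eigenvector for an eigenvalue of modulus \<open>\<rho> G\<close>, the triangle inequality shows
  that the Rayleigh quotient at the vector of absolute values of \<open>z\<close> is at least \<open>\<rho> G\<close>. So the two
  numbers agree, and this vector is a nonnegative maximizer.\<close>

lemma spectral_radius_rayleigh:
  assumes G: "is_hypergraph G"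
  shows "quad_form (verts G) (adj G) y \<le> \<rho> G * (\<Sum>i\<in>verts G. (y i)\<^sup>2)"
    and "\<exists>x. (\<forall>i\<in>verts G. 0 \<le> x i) \<and> (\<exists>i\<in>verts G. x i \<noteq> 0) \<and>
           quad_form (verts G) (adj G) x = \<rho> G * (\<Sum>i\<in>verts G. (x i)\<^sup>2)"
proof -
  let ?V = "verts G" and ?A = "adj G"
  have fin: "finite ?V" and ne: "?V \<noteq> {}" using G by (auto simp: is_hypergraph_def)
  obtain x where x1: "(\<Sum>i\<in>?V. (x i)\<^sup>2) = 1"
    and mx: "\<And>y. quad_form ?V ?A y \<le> quad_form ?V ?A x * (\<Sum>i\<in>?V. (y i)\<^sup>2)"
    using rayleigh_maximizer_exists[OF fin ne, of ?A] by blast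
  define M where "M = quad_form ?V ?A x"
  have ev: "(\<Sum>j\<in>?V. ?A i j * x j) = M * x i" if "i \<in> ?V" for i
    by (rule rayleigh_maximizer_eigenvector[OF fin adj_sym mx[folded M_def] _ that])
      (simp add: M_def x1)
  have nz: "\<exists>i\<in>?V. x i \<noteq> 0"
    using x1 by (metis (mono_tags, lifting) power_zero_numeral sum.neutral zero_neq_one)
  have "eigenvalue (map_mat complex_of_real (adjacency_matrix G)) (complex_of_real M)"
    unfolding eigenvalue_adjacency_matrix[OF fin]
  proof (intro exI[of _ "\<lambda>i. complex_of_real (x i)"] conjI ballI)
    fix i assume "i \<in> ?V"
    from ev[OF this, THEN arg_cong[where f = complex_of_real]]
    show "(\<Sum>j\<in>?V. complex_of_real (?A i j) * complex_of_real (x j)) =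
       complex_of_real M * complex_of_real (x i)" by simp
  qed (use nz in auto)
  from spectral_radius_eigenvalue(2)[OF G this] have M_le: "M \<le> \<rho> G" by simp
  obtain c where c: "cmod c = \<rho> G"
    and "eigenvalue (map_mat complex_of_real (adjacency_matrix G)) c"
    using spectral_radius_eigenvalue(1)[OF G] by blast
  then obtain z where znz: "\<exists>i\<in>?V. z i \<noteq> 0"
    and zev: "\<And>i. i \<in> ?V \<Longrightarrow> (\<Sum>j\<in>?V. complex_of_real (?A i j) * z j) = c * z i"
    unfolding eigenvalue_adjacency_matrix[OF fin] by blast
  define y where "y i = cmod (z i)" for i
  have "\<rho> G * y i \<le> (\<Sum>j\<in>?V. ?A i j * y j)" if "i \<in> ?V" for i
  proof -
    have "\<rho> G * y i = cmod (\<Sum>j\<in>?V. complex_of_real (?A i j) * z j)"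
      unfolding zev[OF that] by (simp add: c y_def norm_mult)
    also have "\<dots> \<le> (\<Sum>j\<in>?V. cmod (complex_of_real (?A i j) * z j))" by (rule norm_sum)
    also have "\<dots> = (\<Sum>j\<in>?V. ?A i j * y j)"
      by (simp add: norm_mult y_def adj_nonneg[OF G])
    finally show ?thesis .
  qed
  then have "(\<Sum>i\<in>?V. y i * (\<rho> G * y i)) \<le> quad_form ?V ?A y"
    unfolding quad_form_def by (intro sum_mono mult_left_mono) (auto simp: y_def)
  then have ge: "\<rho> G * (\<Sum>i\<in>?V. (y i)\<^sup>2) \<le> quad_form ?V ?A y"
    by (simp add: sum_distrib_left power2_eq_square algebra_simps)
  obtain i where i: "i \<in> ?V" "y i \<noteq> 0" using znz by (auto simp: y_def)
  have "0 < (\<Sum>i\<in>?V. (y i)\<^sup>2)"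
    using i fin by (intro sum_pos2[of _ i]) auto
  moreover have "\<rho> G * (\<Sum>i\<in>?V. (y i)\<^sup>2) \<le> M * (\<Sum>i\<in>?V. (y i)\<^sup>2)"
    using ge mx[of y] unfolding M_def by simp
  ultimately have "\<rho> G = M" using M_le by simp
  then show le: "quad_form ?V ?A y \<le> \<rho> G * (\<Sum>i\<in>?V. (y i)\<^sup>2)" for y
    using mx unfolding M_def by simp
  show "\<exists>x. (\<forall>i\<in>?V. 0 \<le> x i) \<and> (\<exists>i\<in>?V. x i \<noteq> 0) \<and>
           quad_form ?V ?A x = \<rho> G * (\<Sum>i\<in>?V. (x i)\<^sup>2)"
    using i by (intro exI[of _ y] conjI antisym[OF le ge]) (auto simp: y_def)
qed

definition share_edge :: "'a set set \<Rightarrow> ('a \<times> 'a) set" where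
  "share_edge F = {(a, b). \<exists>e\<in>F. a \<in> e \<and> b \<in> e}"

lemma connected_imp_share_edge_rtrancl:
  assumes conn: "connected_hypergraph G" and u: "u \<in> verts G" and w: "w \<in> verts G"
  shows "(u, w) \<in> (share_edge (edges G))\<^sup>*"
proof (cases "u = w")
  case False
  then obtain vs es where p: "Defs.path G vs es" and hd: "hd vs = u" and la: "last vs = w"
    using conn u w unfolding connected_hypergraph_def by blast
  have len: "length vs = length es + 1" using p by (simp add: Defs.path_def)
  have "(vs ! 0, vs ! i) \<in> (share_edge (edges G))\<^sup>*" if "i \<le> length es" for i
    using that
  proof (induction i)
    case (Suc i)
    then have "vs ! i \<in> es ! i" "vs ! Suc i \<in> es ! i" "es ! i \<in> edges G"
      using p by (auto simp: Defs.path_def)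
    then have "(vs ! i, vs ! Suc i) \<in> share_edge (edges G)" by (auto simp: share_edge_def)
    then show ?case using Suc by (meson Suc_leD rtrancl.rtrancl_into_rtrancl)
  qed simp
  moreover have "vs \<noteq> []" using len by auto
  ultimately show ?thesis
    using hd la len by (metis add_diff_cancel_right' hd_conv_nth last_conv_nth order_refl)
qed simp

lemma adj_pos:
  assumes G: "is_hypergraph G" and e: "e \<in> edges G" "i \<in> e" "j \<in> e" and ij: "i \<noteq> j"
  shows "0 < adj G i j"
proof -
  have ge: "2 \<le> card e" if "e \<in> edges G" for e using G that by (auto simp: is_hypergraph_def)
  have "0 < (\<Sum>e\<in>{e\<in>edges G. i \<in> e \<and> j \<in> e}. 1 / (real (card e) - 1))"
    using e ge[OF e(1)] finite_edges[OF G]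
    by (intro sum_pos2[of _ e]) (auto dest: ge)
  then show ?thesis using ij by (simp add: adj_def)
qed

text \<open>A zero of a nonnegative eigenvector at \<open>b\<close> forces zeros at all neighbours of \<open>b\<close>, so by
  connectedness a nonnegative eigenvector that is not zero is positive everywhere.\<close>

lemma perron_vector:
  assumes G: "is_hypergraph G" and conn: "connected_hypergraph G"
  obtains x where "\<And>i. i \<in> verts G \<Longrightarrow> 0 < x i"
    and "\<And>i. i \<in> verts G \<Longrightarrow> (\<Sum>j\<in>verts G. adj G i j * x j) = \<rho> G * x i"
    and "quad_form (verts G) (adj G) x = \<rho> G * (\<Sum>i\<in>verts G. (x i)\<^sup>2)"
proof -
  let ?V = "verts G"
  have fin: "finite ?V" using G by (simp add: is_hypergraph_def)
  obtain x where nn: "\<And>i. i \<in> ?V \<Longrightarrow> 0 \<le> x i" and nz: "\<exists>i\<in>?V. x i \<noteq> 0"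
    and q: "quad_form ?V (adj G) x = \<rho> G * (\<Sum>i\<in>?V. (x i)\<^sup>2)"
    using spectral_radius_rayleigh(2)[OF G] by blast
  have ev: "(\<Sum>j\<in>?V. adj G i j * x j) = \<rho> G * x i" if "i \<in> ?V" for i
    by (rule rayleigh_maximizer_eigenvector[OF fin adj_sym spectral_radius_rayleigh(1)[OF G] q that])
  obtain u where u: "u \<in> ?V" "0 < x u" using nz nn by (metis less_le)
  have "v \<in> ?V \<Longrightarrow> 0 < x v" if "(u, v) \<in> (share_edge (edges G))\<^sup>*" for v
    using that
  proof (induction rule: rtrancl_induct)
    case (step a b)
    then obtain e where e: "e \<in> edges G" "a \<in> e" "b \<in> e" by (auto simp: share_edge_def)
    have a: "a \<in> ?V" using e G by (auto simp: is_hypergraph_def)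
    with step have xa: "0 < x a" by blast
    show ?case
    proof (cases "a = b")
      case False
      have "0 < adj G b a * x a" using adj_pos[OF G e(1,3,2)] False xa by simp
      also have "\<dots> \<le> (\<Sum>j\<in>?V. adj G b j * x j)"
        using a fin nn adj_nonneg[OF G] by (intro member_le_sum) auto
      also have "\<dots> = \<rho> G * x b" using ev step.prems by blast
      finally show ?thesis using nn[OF step.prems] by (metis less_le mult_zero_right)
    qed (use xa in simp)
  qed (use u in simp)
  then have "0 < x v" if "v \<in> ?V" for v
    using that connected_imp_share_edge_rtrancl[OF conn u(1) that] by blast
  with ev q show ?thesis using that by blast
qed

section \<open>Moving edges to a vertex of maximal weight\<close>

text \<open>The sum of \<open>x i * x j\<close> over all ordered pairs of distinct vertices of \<open>e\<close>, written as a
  difference of squares so that the effect of inserting a vertex is an algebraic identity.\<close>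

definition pair_sum :: "('a \<Rightarrow> real) \<Rightarrow> 'a set \<Rightarrow> real" where
  "pair_sum x e = (\<Sum>i\<in>e. x i)\<^sup>2 - (\<Sum>i\<in>e. (x i)\<^sup>2)"

text \<open>For a \<open>k\<close>-uniform hypergraph, \<open>k - 1\<close> times the contribution of \<open>e\<close> to row \<open>i\<close> of the adjacency
  matrix applied to \<open>x\<close>.\<close>

definition edge_load :: "('a \<Rightarrow> real) \<Rightarrow> 'a \<Rightarrow> 'a set \<Rightarrow> real" where
  "edge_load x i e = (if i \<in> e then \<Sum>j\<in>e - {i}. x j else 0)"

lemma adj_sum_eq_edge_load:
  assumes G: "is_hypergraph G" and unif: "uniform k G"
  shows "(\<Sum>j\<in>verts G. adj G i j * x j) = (\<Sum>e\<in>edges G. edge_load x i e) / (real k - 1)"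
proof -
  let ?V = "verts G" and ?E = "edges G" and ?r = "1 / (real k - 1)"
  have fin: "finite ?V" and sub: "\<And>e. e \<in> ?E \<Longrightarrow> e \<subseteq> ?V" using G by (auto simp: is_hypergraph_def)
  have "adj G i j = (\<Sum>e\<in>?E. if i \<in> e \<and> j \<in> e - {i} then ?r else 0)" for j
  proof (cases "i = j")
    case False
    then have "adj G i j = (\<Sum>e\<in>{e\<in>?E. i \<in> e \<and> j \<in> e}. ?r)"
      using unif by (auto simp: adj_def uniform_def intro!: sum.cong)
    also have "\<dots> = (\<Sum>e\<in>?E. if i \<in> e \<and> j \<in> e then ?r else 0)"
      using finite_edges[OF G] by (rule sum.inter_filter)
    finally show ?thesis using False by simp
  qed (simp add: adj_def)
  then have "(\<Sum>j\<in>?V. adj G i j * x j) =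
      (\<Sum>j\<in>?V. \<Sum>e\<in>?E. (if i \<in> e \<and> j \<in> e - {i} then ?r else 0) * x j)"
    by (simp add: sum_distrib_right)
  also have "\<dots> = (\<Sum>e\<in>?E. \<Sum>j\<in>?V. (if i \<in> e \<and> j \<in> e - {i} then ?r else 0) * x j)"
    by (rule sum.swap)
  also have "\<dots> = (\<Sum>e\<in>?E. edge_load x i e * ?r)"
  proof (intro sum.cong refl)
    fix e assume e: "e \<in> ?E"
    show "(\<Sum>j\<in>?V. (if i \<in> e \<and> j \<in> e - {i} then ?r else 0) * x j) = edge_load x i e * ?r"
    proof (cases "i \<in> e")
      case True
      have "(\<Sum>j\<in>?V. (if i \<in> e \<and> j \<in> e - {i} then ?r else 0) * x j) = (\<Sum>j\<in>e - {i}. ?r * x j)"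
        using fin sub[OF e] True by (intro sum.mono_neutral_cong_right) auto
      then show ?thesis using True by (simp add: edge_load_def sum_distrib_left mult.commute)
    qed (simp add: edge_load_def)
  qed
  finally show ?thesis by (simp add: sum_divide_distrib)
qed

lemma quad_form_eq_pair_sum:
  assumes G: "is_hypergraph G" and unif: "uniform k G"
  shows "quad_form (verts G) (adj G) x = (\<Sum>e\<in>edges G. pair_sum x e) / (real k - 1)"
proof -
  let ?V = "verts G" and ?E = "edges G"
  have fin: "finite ?V" and sub: "\<And>e. e \<in> ?E \<Longrightarrow> e \<subseteq> ?V" using G by (auto simp: is_hypergraph_def)
  have "quad_form ?V (adj G) x = (\<Sum>i\<in>?V. \<Sum>e\<in>?E. x i * edge_load x i e) / (real k - 1)"
    unfolding quad_form_def adj_sum_eq_edge_load[OF assms]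
    by (simp add: sum_distrib_left sum_divide_distrib)
  also have "(\<Sum>i\<in>?V. \<Sum>e\<in>?E. x i * edge_load x i e) = (\<Sum>e\<in>?E. \<Sum>i\<in>?V. x i * edge_load x i e)"
    by (rule sum.swap)
  also have "\<dots> = (\<Sum>e\<in>?E. pair_sum x e)"
  proof (intro sum.cong refl)
    fix e assume e: "e \<in> ?E"
    have fe: "finite e" using sub[OF e] fin finite_subset by blast
    have "(\<Sum>i\<in>?V. x i * edge_load x i e) = (\<Sum>i\<in>e. x i * sum x e - (x i)\<^sup>2)"
      using fin sub[OF e] fe
      by (intro sum.mono_neutral_cong_right)
        (auto simp: edge_load_def sum_diff1 power2_eq_square algebra_simps)
    then show "(\<Sum>i\<in>?V. x i * edge_load x i e) = pair_sum x e"
      by (simp add: pair_sum_def sum_subtractf sum_distrib_right[symmetric] power2_eq_square)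
  qed
  finally show ?thesis .
qed

lemma pair_sum_insert:
  assumes "finite T" "a \<notin> T"
  shows "pair_sum x (insert a T) = pair_sum x T + 2 * x a * (\<Sum>i\<in>T. x i)"
  using assms by (simp add: pair_sum_def power2_eq_square algebra_simps)

text \<open>In an edge \<open>e\<close>, replacing \<open>a\<close> by \<open>w\<close> changes the edge's part of the quadratic form by a positive
  multiple of \<open>(x w - x a) * (\<Sum>i\<in>e - {a}. x i)\<close>, which is nonnegative. This difference may vanish
  for \<open>x a = x w\<close>, so the equality case is read off from the eigenvalue equation at \<open>w\<close> instead:
  there every moved edge adds the positive sum \<open>\<Sum>i\<in>e - {a}. x i\<close>, and nothing is lost because
  edges through \<open>w\<close> are kept.\<close>

lemma edge_shift_spectral_radius:
  fixes G G' :: "'a hypergraph"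
  assumes G: "is_hypergraph G" and unif: "uniform k G" and k: "2 \<le> k"
    and pos: "\<And>i. i \<in> verts G \<Longrightarrow> 0 < x i"
    and ev: "\<And>i. i \<in> verts G \<Longrightarrow> (\<Sum>j\<in>verts G. adj G i j * x j) = \<rho> G * x i"
    and q: "quad_form (verts G) (adj G) x = \<rho> G * (\<Sum>i\<in>verts G. (x i)\<^sup>2)"
    and w: "w \<in> verts G" and mx: "\<And>v. v \<in> verts G \<Longrightarrow> x v \<le> x w"
    and V': "verts G' = verts G" and E': "edges G' = \<phi> ` edges G" and inj: "inj_on \<phi> (edges G)"
    and shift: "\<And>e. e \<in> edges G \<Longrightarrow> \<phi> e = e \<or> (\<exists>a\<in>e. w \<notin> e \<and> \<phi> e = insert w (e - {a}))"
  shows "is_hypergraph G'" and "\<rho> G \<le> \<rho> G'" and "\<rho> G = \<rho> G' \<Longrightarrow> G = G'"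
proof -
  let ?V = "verts G" and ?E = "edges G"
  have fin: "finite ?V" and ne: "?V \<noteq> {}" and sub: "\<And>e. e \<in> ?E \<Longrightarrow> e \<subseteq> ?V"
    using G by (auto simp: is_hypergraph_def)
  have fe: "finite e" and ce: "card e = k" if "e \<in> ?E" for e
    using sub[OF that] fin finite_subset unif that by (auto simp: uniform_def)
  have shifted: "\<phi> e \<subseteq> ?V \<and> card (\<phi> e) = k" if e: "e \<in> ?E" for e
    using shift[OF e] sub[OF e] w fe[OF e] ce[OF e] k by (auto simp: card_insert_if card_gt_0_iff)
  have G': "is_hypergraph G'" and unif': "uniform k G'"
    using fin ne k shifted by (auto simp: is_hypergraph_def uniform_def V' E')
  show "is_hypergraph G'" by (rule G')
  have k1: "0 < real k - 1" using k by simp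
  have pair_le: "pair_sum x e \<le> pair_sum x (\<phi> e)" if e: "e \<in> ?E" for e
    using shift[OF e]
  proof
    assume "\<exists>a\<in>e. w \<notin> e \<and> \<phi> e = insert w (e - {a})"
    then obtain a where a: "a \<in> e" "w \<notin> e" "\<phi> e = insert w (e - {a})" by blast
    have "pair_sum x e = pair_sum x (insert a (e - {a}))" using a by (simp add: insert_absorb)
    also have "\<dots> = pair_sum x (e - {a}) + 2 * x a * (\<Sum>i\<in>e - {a}. x i)"
      using fe[OF e] by (intro pair_sum_insert) auto
    also have "\<dots> \<le> pair_sum x (e - {a}) + 2 * x w * (\<Sum>i\<in>e - {a}. x i)"
      using mx[of a] pos sub[OF e] a
      by (intro add_left_mono mult_right_mono sum_nonneg) (auto simp: less_imp_le subset_iff)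
    also have "\<dots> = pair_sum x (\<phi> e)"
      unfolding a(3) using fe[OF e] a by (intro pair_sum_insert[symmetric]) auto
    finally show ?thesis .
  qed simp
  have "quad_form ?V (adj G) x \<le> quad_form (verts G') (adj G') x"
    unfolding quad_form_eq_pair_sum[OF G unif] quad_form_eq_pair_sum[OF G' unif'] E'
      sum.reindex[OF inj] o_def
    using k1 pair_le by (intro divide_right_mono sum_mono) auto
  also have le': "\<dots> \<le> \<rho> G' * (\<Sum>i\<in>?V. (x i)\<^sup>2)"
    using spectral_radius_rayleigh(1)[OF G', of x] by (simp add: V')
  finally have chain: "\<rho> G * (\<Sum>i\<in>?V. (x i)\<^sup>2) \<le> \<rho> G' * (\<Sum>i\<in>?V. (x i)\<^sup>2)"
    using q by simp
  have "0 < (\<Sum>i\<in>?V. (x i)\<^sup>2)" using pos[OF w] w fin by (intro sum_pos2[of _ w]) auto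
  then show "\<rho> G \<le> \<rho> G'" using chain by simp
  assume eq: "\<rho> G = \<rho> G'"
  have fin': "finite (verts G')" using fin V' by simp
  have q': "quad_form (verts G') (adj G') x = \<rho> G' * (\<Sum>i\<in>verts G'. (x i)\<^sup>2)"
    using le' \<open>quad_form ?V (adj G) x \<le> _\<close> q eq by (simp add: V')
  have "(\<Sum>j\<in>verts G'. adj G' w j * x j) = \<rho> G' * x w"
    by (rule rayleigh_maximizer_eigenvector
        [OF fin' adj_sym spectral_radius_rayleigh(1)[OF G'] q']) (use w V' in simp)
  then have "(\<Sum>e\<in>?E. edge_load x w (\<phi> e)) = (\<Sum>e\<in>?E. edge_load x w e)"
    using ev[OF w] k1 eq
    unfolding adj_sum_eq_edge_load[OF G unif] adj_sum_eq_edge_load[OF G' unif'] E'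
      sum.reindex[OF inj] o_def by (metis divide_cancel_right less_irrefl)
  then have sum0: "(\<Sum>e\<in>?E. edge_load x w (\<phi> e) - edge_load x w e) = 0"
    by (simp add: sum_subtractf)
  have gain: "0 < edge_load x w (\<phi> e) - edge_load x w e" if e: "e \<in> ?E" and moved: "\<phi> e \<noteq> e" for e
  proof -
    obtain a where a: "a \<in> e" "w \<notin> e" "\<phi> e = insert w (e - {a})" using shift[OF e] moved by blast
    have "card (e - {a}) = k - 1" using fe[OF e] ce[OF e] a(1) by simp
    then have "e - {a} \<noteq> {}" using k by (metis card.empty diff_is_0_eq not_less_eq_eq numeral_2_eq_2 One_nat_def)
    then have "0 < (\<Sum>i\<in>e - {a}. x i)"
      using fe[OF e] pos sub[OF e] by (intro sum_pos) auto
    moreover have "insert w (e - {a}) - {w} = e - {a}" using a by auto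
    ultimately show ?thesis using a by (simp add: edge_load_def)
  qed
  have "\<phi> e = e" if e: "e \<in> ?E" for e
  proof (rule ccontr)
    assume ne: "\<phi> e \<noteq> e"
    have "0 \<le> edge_load x w (\<phi> e) - edge_load x w e" if "e \<in> ?E" for e
      using gain[OF that] by (cases "\<phi> e = e") auto
    then have "0 < (\<Sum>e\<in>?E. edge_load x w (\<phi> e) - edge_load x w e)"
      using gain[OF e ne] e finite_edges[OF G] by (intro sum_pos2[of _ e]) auto
    then show False using sum0 by simp
  qed
  then have "edges G' = edges G" by (simp add: E')
  then show "G = G'" using V' by simp
qed

section \<open>Isomorphic hypergraphs\<close>

lemma hypergraph_iso_adj:
  assumes f: "bij_betw f (verts G) (verts H)" and fe: "bij_betw (\<lambda>e. f ` e) (edges G) (edges H)"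
    and sub: "\<And>e. e \<in> edges G \<Longrightarrow> e \<subseteq> verts G" and i: "i \<in> verts G" and j: "j \<in> verts G"
  shows "adj H (f i) (f j) = adj G i j"
proof -
  have inj: "inj_on f (verts G)" using f by (simp add: bij_betw_def)
  have mem: "f a \<in> f ` e \<longleftrightarrow> a \<in> e" if "e \<in> edges G" "a \<in> verts G" for a e
    using inj_on_image_mem_iff[OF inj that(2) sub[OF that(1)]] .
  have "bij_betw (\<lambda>e. f ` e) {e \<in> edges G. i \<in> e \<and> j \<in> e} {e \<in> edges H. f i \<in> e \<and> f j \<in> e}"
    unfolding bij_betw_def
  proof
    show "inj_on (\<lambda>e. f ` e) {e \<in> edges G. i \<in> e \<and> j \<in> e}"
      using fe by (auto simp: bij_betw_def intro: inj_on_subset)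
    have "edges H = (\<lambda>e. f ` e) ` edges G" using fe by (simp add: bij_betw_def)
    moreover have "{e \<in> edges G. i \<in> e \<and> j \<in> e} = {e \<in> edges G. f i \<in> f ` e \<and> f j \<in> f ` e}"
      using mem i j by (intro Collect_cong) metis
    ultimately show "(\<lambda>e. f ` e) ` {e \<in> edges G. i \<in> e \<and> j \<in> e} = {e \<in> edges H. f i \<in> e \<and> f j \<in> e}"
      by (simp only:) blast
  qed
  then have "(\<Sum>e\<in>{e \<in> edges H. f i \<in> e \<and> f j \<in> e}. 1 / (real (card e) - 1)) =
      (\<Sum>e\<in>{e \<in> edges G. i \<in> e \<and> j \<in> e}. 1 / (real (card (f ` e)) - 1))"
    by (rule sum.reindex_bij_betw[symmetric])
  also have "\<dots> = (\<Sum>e\<in>{e \<in> edges G. i \<in> e \<and> j \<in> e}. 1 / (real (card e) - 1))"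
    using sub inj by (intro sum.cong refl) (metis (mono_tags, lifting) card_image inj_on_subset mem_Collect_eq)
  finally show ?thesis using inj i j by (auto simp: adj_def inj_on_eq_iff)
qed

lemma hypergraph_iso_sym:
  assumes iso: "G \<cong>\<^sub>H H" and sub: "\<And>e. e \<in> edges G \<Longrightarrow> e \<subseteq> verts G"
  shows "H \<cong>\<^sub>H G"
proof -
  obtain f where f: "bij_betw f (verts G) (verts H)" and fe: "bij_betw (\<lambda>e. f ` e) (edges G) (edges H)"
    using iso unfolding hypergraph_iso_def by blast
  let ?h = "inv_into (verts G) f"
  have inj: "inj_on f (verts G)" using f by (simp add: bij_betw_def)
  have cancel: "?h ` (f ` e) = e" if "e \<in> edges G" for e
    using inv_into_image_cancel[OF inj sub[OF that]] .
  have EH: "edges H = (\<lambda>e. f ` e) ` edges G" using fe by (simp add: bij_betw_def)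
  have "bij_betw (\<lambda>e. ?h ` e) (edges H) (edges G)"
    by (rule bij_betw_byWitness[where f' = "\<lambda>e. f ` e"])
      (use cancel in \<open>simp_all add: EH image_image[of _ "\<lambda>e. f ` e"] image_subset_iff\<close>)
  then show ?thesis using bij_betw_inv_into[OF f] unfolding hypergraph_iso_def by blast
qed

lemma hypergraph_iso_spectral_radius_le:
  assumes G: "is_hypergraph G" and H: "is_hypergraph H" and iso: "G \<cong>\<^sub>H H"
  shows "\<rho> G \<le> \<rho> H"
proof -
  obtain f where f: "bij_betw f (verts G) (verts H)" and fe: "bij_betw (\<lambda>e. f ` e) (edges G) (edges H)"
    using iso unfolding hypergraph_iso_def by blast
  have sub: "\<And>e. e \<in> edges G \<Longrightarrow> e \<subseteq> verts G" using G by (auto simp: is_hypergraph_def)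
  have finG: "finite (verts G)" using G by (simp add: is_hypergraph_def)
  obtain x where nz: "\<exists>i\<in>verts G. x i \<noteq> 0"
    and q: "quad_form (verts G) (adj G) x = \<rho> G * (\<Sum>i\<in>verts G. (x i)\<^sup>2)"
    using spectral_radius_rayleigh(2)[OF G] by blast
  define y where "y = x \<circ> inv_into (verts G) f"
  have y: "y (f i) = x i" if "i \<in> verts G" for i
    using that f by (simp add: y_def bij_betw_def inv_into_f_f)
  have reidx: "(\<Sum>i\<in>verts H. h i) = (\<Sum>i\<in>verts G. h (f i))" for h :: "'b \<Rightarrow> real"
    using sum.reindex_bij_betw[OF f, of h] by simp
  have "quad_form (verts H) (adj H) y = quad_form (verts G) (adj G) x"
    unfolding quad_form_def reidx
    by (intro sum.cong refl) (simp add: y hypergraph_iso_adj[OF f fe sub])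
  moreover have "(\<Sum>i\<in>verts H. (y i)\<^sup>2) = (\<Sum>i\<in>verts G. (x i)\<^sup>2)"
    unfolding reidx by (intro sum.cong refl) (simp add: y)
  ultimately have "\<rho> G * (\<Sum>i\<in>verts G. (x i)\<^sup>2) \<le> \<rho> H * (\<Sum>i\<in>verts G. (x i)\<^sup>2)"
    using spectral_radius_rayleigh(1)[OF H, of y] q by simp
  moreover obtain i where "i \<in> verts G" "x i \<noteq> 0" using nz by blast
  then have "0 < (\<Sum>i\<in>verts G. (x i)\<^sup>2)" using finG by (intro sum_pos2[of _ i]) auto
  ultimately show ?thesis by simp
qed

section \<open>Rooting a tree of edges\<close>

text \<open>The sum condition is the edge count of a tree, for edges of arbitrary sizes.
  Measure distances from \<open>w\<close> by the number of steps along edges and let \<open>p e\<close> be a vertex of \<open>e\<close>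
  nearest to \<open>w\<close>. On a shortest walk from \<open>w\<close> to \<open>u \<noteq> w\<close> the last edge contains a vertex nearer
  than \<open>u\<close>, so \<open>u\<close> belongs to \<open>e - {p e}\<close> for that edge. Hence these sets cover all vertices but
  \<open>w\<close>, and if two of them overlapped there would be too few elements to do so.\<close>

lemma rooted_edge_partition:
  fixes V :: "'a set"
  assumes fin: "finite V" and w: "w \<in> V" and finF: "finite F"
    and F: "\<And>e. e \<in> F \<Longrightarrow> e \<subseteq> V \<and> e \<noteq> {}"
    and conn: "\<And>u. u \<in> V \<Longrightarrow> (w, u) \<in> (share_edge F)\<^sup>*"
    and count: "(\<Sum>e\<in>F. card e - 1) = card V - 1"
  obtains p where "\<And>e. e \<in> F \<Longrightarrow> p e \<in> e" and "\<And>e. e \<in> F \<Longrightarrow> w \<in> e \<Longrightarrow> p e = w"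
    and "\<And>e f. e \<in> F \<Longrightarrow> f \<in> F \<Longrightarrow> e \<noteq> f \<Longrightarrow> (e - {p e}) \<inter> (f - {p f}) = {}"
    and "(\<Union>e\<in>F. e - {p e}) = V - {w}"
proof -
  define dst where "dst u = (LEAST n. (w, u) \<in> share_edge F ^^ n)" for u
  define p where "p e = arg_min dst (\<lambda>u. u \<in> e)" for e
  have p: "p e \<in> e" and p_le: "u \<in> e \<Longrightarrow> dst (p e) \<le> dst u" if e: "e \<in> F" for e u
  proof -
    obtain v where "v \<in> e" using F[OF e] by blast
    then show "p e \<in> e" "u \<in> e \<Longrightarrow> dst (p e) \<le> dst u"
      unfolding p_def using arg_min_nat_lemma[of "\<lambda>u. u \<in> e" v dst] by auto
  qed
  have reach: "(w, u) \<in> share_edge F ^^ dst u" if u: "u \<in> V" for u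
  proof -
    obtain n where "(w, u) \<in> share_edge F ^^ n" using rtrancl_imp_relpow[OF conn[OF u]] by blast
    then show ?thesis unfolding dst_def by (rule LeastI)
  qed
  have dst_w: "dst w = 0" unfolding dst_def by (rule Least_eq_0) simp
  have pw: "p e = w" if "e \<in> F" "w \<in> e" for e
  proof -
    have "dst (p e) = 0" using p_le[OF that] dst_w by simp
    moreover have "p e \<in> V" using p[OF that(1)] F[OF that(1)] by blast
    ultimately show ?thesis using reach[of "p e"] by simp
  qed
  have cover: "\<exists>e\<in>F. u \<in> e - {p e}" if u: "u \<in> V" "u \<noteq> w" for u
  proof -
    have "dst u \<noteq> 0" using reach[OF u(1)] u(2) by (metis relpow_0_E)
    then obtain d where d: "dst u = Suc d" by (metis not0_implies_Suc)
    then obtain v where v: "(w, v) \<in> share_edge F ^^ d" "(v, u) \<in> share_edge F"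
      using reach[OF u(1)] by auto
    then obtain e where e: "e \<in> F" "v \<in> e" "u \<in> e" by (auto simp: share_edge_def)
    have "dst v \<le> d" unfolding dst_def by (rule Least_le) (rule v(1))
    then have "dst (p e) < dst u" using p_le[OF e(1,2)] d by simp
    then show ?thesis using e by blast
  qed
  have union: "(\<Union>e\<in>F. e - {p e}) = V - {w}" using cover F pw by blast
  have fe: "finite e" if "e \<in> F" for e using F[OF that] fin finite_subset by blast
  have disj: "(e - {p e}) \<inter> (f - {p f}) = {}" if ef: "e \<in> F" "f \<in> F" "e \<noteq> f" for e f
  proof (rule ccontr)
    assume "(e - {p e}) \<inter> (f - {p f}) \<noteq> {}"
    then obtain z where z: "z \<in> e - {p e}" "z \<in> f - {p f}" by blast
    \<comment> \<open>Deleting the doubly covered \<open>z\<close> from one of the two sets keeps the cover but lowers the count.\<close>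
    define S where "S d = (if d = f then f - {p f} - {z} else d - {p d})" for d
    have "V - {w} = (\<Union>d\<in>F. S d)"
    proof (intro equalityI subsetI)
      fix u assume "u \<in> V - {w}"
      then obtain d where d: "d \<in> F" "u \<in> d - {p d}" unfolding union[symmetric] by blast
      show "u \<in> (\<Union>d\<in>F. S d)"
      proof (cases "d = f \<and> u = z")
        case True
        then have "u \<in> S e" using z ef by (simp add: S_def)
        then show ?thesis using ef by blast
      next
        case False
        then have "u \<in> S d" using d by (auto simp: S_def)
        then show ?thesis using d by blast
      qed
    next
      fix u assume "u \<in> (\<Union>d\<in>F. S d)"
      then show "u \<in> V - {w}" unfolding union[symmetric] by (auto simp: S_def split: if_splits)
    qed
    then have "card V - 1 \<le> (\<Sum>d\<in>F. card (S d))"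
      using card_UN_le[OF finF, of S] w by (metis card_Diff_singleton)
    also have "\<dots> < (\<Sum>d\<in>F. card d - 1)"
    proof (rule sum_strict_mono_ex1[OF finF])
      show "\<forall>d\<in>F. card (S d) \<le> card d - 1"
        using p fe by (auto simp: S_def card_Diff_singleton_if)
      have "card (S f) = card f - 1 - 1"
        using z p[OF ef(2)] by (simp add: S_def card_Diff_singleton)
      moreover have "card (f - {p f}) > 0" using z fe[OF ef(2)] card_gt_0_iff by blast
      then have "card f - 1 > 0" using p[OF ef(2)] by (simp add: card_Diff_singleton)
      ultimately show "\<exists>d\<in>F. card (S d) < card d - 1" using ef(2) by force
    qed
    finally show False using count by simp
  qed
  show ?thesis using that[OF p pw disj union] by blast
qed

section \<open>Hypercycles as cyclic families\<close>

text \<open>The vertex \<open>c i\<close> is common to the cycle edges number \<open>i - 1\<close> and \<open>i\<close> modulo \<open>g\<close>, and \<open>I i\<close> collects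
  the vertices of edge number \<open>i\<close> that lie on no other cycle edge. Stating disjointness for these
  pieces rather than intersections of edges treats \<open>g = 2\<close>, where the two edges share two vertices,
  in the same way as larger \<open>g\<close>.\<close>

definition loose_cycle :: "nat \<Rightarrow> nat \<Rightarrow> (nat \<Rightarrow> 'a) \<Rightarrow> (nat \<Rightarrow> 'a set) \<Rightarrow> bool" where
  "loose_cycle k g c I \<longleftrightarrow> inj_on c {..<g} \<and> disjoint_family_on I {..<g} \<and>
     (\<forall>i<g. card (I i) = k - 2 \<and> (\<forall>j<g. c j \<notin> I i))"

definition loose_cycle_edge :: "nat \<Rightarrow> (nat \<Rightarrow> 'a) \<Rightarrow> (nat \<Rightarrow> 'a set) \<Rightarrow> nat \<Rightarrow> 'a set" where
  "loose_cycle_edge g c I i = {c i, c (Suc i mod g)} \<union> I i"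

definition loose_cycle_verts :: "nat \<Rightarrow> (nat \<Rightarrow> 'a) \<Rightarrow> (nat \<Rightarrow> 'a set) \<Rightarrow> 'a set" where
  "loose_cycle_verts g c I = c ` {..<g} \<union> (\<Union>i<g. I i)"

text \<open>Both shapes of a hypercycle are reduced to a cyclic sequence \<open>D\<close> of edges such that an edge
  meets any other one only in its own two vertices of \<open>c\<close>. Taking these away leaves sets that are
  pairwise disjoint and avoid \<open>c\<close>.\<close>

lemma hypercycle_imp_loose_cycle:
  assumes G: "is_hypergraph G" and unif: "uniform k G" and hc: "has_hypercycle G g"
  obtains c I where "2 \<le> g" "loose_cycle k g c I" "\<And>i. i < g \<Longrightarrow> loose_cycle_edge g c I i \<in> edges G"
proof -
  note result = that
  have main: ?thesis if g: "2 \<le> g"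
    and inj: "inj_on c {..<g}"
    and D: "\<And>i. i < g \<Longrightarrow> D i \<in> edges G \<and> c i \<in> D i \<and> c (Suc i mod g) \<in> D i"
    and meet: "\<And>i j. i < g \<Longrightarrow> j < g \<Longrightarrow> i \<noteq> j \<Longrightarrow>
       D i \<inter> D j \<subseteq> {c i, c (Suc i mod g)}"
    for c :: "nat \<Rightarrow> 'a" and D
  proof -
    define I where "I i = D i - {c i, c (Suc i mod g)}" for i
    have edge: "loose_cycle_edge g c I i = D i" if "i < g" for i
      using D[OF that] by (auto simp: loose_cycle_edge_def I_def)
    have "card (I i) = k - 2" if i: "i < g" for i
    proof -
      have "Suc i mod g \<noteq> i" using g i by (auto simp: mod_Suc)
      then have "c (Suc i mod g) \<noteq> c i" using inj i g by (simp add: inj_on_eq_iff)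
      moreover have "card (D i) = k" using D[OF i] unif by (simp add: uniform_def)
      moreover have "finite (D i)"
        using D[OF i] G by (metis card.infinite is_hypergraph_def not_numeral_le_zero)
      ultimately show ?thesis unfolding I_def using D[OF i] by (subst card_Diff_subset) auto
    qed
    moreover have "disjoint_family_on I {..<g}"
      unfolding disjoint_family_on_def I_def using meet by (auto dest!: subsetD)
    moreover have "c j \<notin> I i" if "i < g" "j < g" for i j
      using meet[OF that] D that by (auto simp: I_def)
    ultimately have "loose_cycle k g c I" using inj by (auto simp: loose_cycle_def)
    then show ?thesis using result[OF g] edge D by simp
  qed
  have two: ?thesis if 1: "g = 2" "e1 \<in> edges G" "e2 \<in> edges G" "e1 \<noteq> e2"
      "v1 \<noteq> v2" "e1 \<inter> e2 = {v1, v2}" for e1 e2 v1 v2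
  proof -
    define c where "c i = (if i = 0 then v1 else v2)" for i :: nat
    define D where "D i = (if i = 0 then e1 else e2)" for i :: nat
    have less_two: "i < 2 \<longleftrightarrow> i = 0 \<or> i = Suc 0" for i :: nat by auto
    have v: "v1 \<in> e1" "v1 \<in> e2" "v2 \<in> e1" "v2 \<in> e2" using 1(6) by blast+
    have c: "c 0 = v1" "c (Suc 0) = v2" and D: "D 0 = e1" "D (Suc 0) = e2"
      by (auto simp: c_def D_def)
    show ?thesis
    proof (rule main[of c D])
      show "inj_on c {..<g}" using 1(1,5) by (auto simp: inj_on_def c_def less_two)
      show "D i \<in> edges G \<and> c i \<in> D i \<and> c (Suc i mod g) \<in> D i" if "i < g" for i
        using that v 1(2,3) unfolding 1(1) less_two by (elim disjE) (simp_all add: c D)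
      show "D i \<inter> D j \<subseteq> {c i, c (Suc i mod g)}" if "i < g" "j < g" "i \<noteq> j" for i j
        using that 1(6) unfolding 1(1) less_two
        by (elim disjE) (simp_all add: c D Int_commute insert_commute)
    qed (use 1 in simp)
  qed
  have long: ?thesis if 2: "3 \<le> g" "hyperpath G vs es" "length vs = g" "e \<in> edges G" "e \<notin> set es"
        "e \<inter> hd es = {hd vs}" "e \<inter> last es = {last vs}"
        "\<forall>j. 0 < j \<and> j + 1 < length es \<longrightarrow> e \<inter> es ! j = {}" for vs es e
  proof -
    have hp: "Defs.path G vs es"
      "\<And>i. i + 1 < length es \<Longrightarrow> es ! i \<inter> es ! (i + 1) = {vs ! (i + 1)}"
      "\<And>i j. i + 2 \<le> j \<Longrightarrow> j < length es \<Longrightarrow> es ! i \<inter> es ! j = {}"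
      using 2(2) unfolding hyperpath_def by auto
    have len: "length es = g - 1" using hp(1) 2(3) by (simp add: Defs.path_def)
    define c where "c i = vs ! i" for i
    define D where "D i = (if i = g - 1 then e else es ! i)" for i
    have inj: "inj_on c {..<g}"
      using hp(1) 2(3) by (auto simp: Defs.path_def c_def inj_on_def nth_eq_iff_index_eq)
    have e0: "e \<inter> es ! 0 = {c 0}"
    proof -
      have "hd es = es ! 0" using len 2(1) by (subst hd_conv_nth) auto
      moreover have "hd vs = c 0" using 2(1,3) by (subst hd_conv_nth) (auto simp: c_def)
      ultimately show ?thesis using 2(6) by simp
    qed
    have elast: "e \<inter> es ! (g - 2) = {c (g - 1)}"
    proof -
      have "last es = es ! (g - 2)" using len 2(1) by (subst last_conv_nth) (auto simp: numeral_2_eq_2)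
      moreover have "last vs = c (g - 1)" using 2(1,3) by (subst last_conv_nth) (auto simp: c_def)
      ultimately show ?thesis using 2(7) by simp
    qed
    have lt: "D i \<inter> D j = (if j = Suc i then {c j} else if i = 0 \<and> j = g - 1 then {c 0} else {})"
      if ij: "i < j" "j < g" for i j
    proof (cases "j = g - 1")
      case True
      then have "i < g - 1" using ij by simp
      then have Dij: "D i \<inter> D j = e \<inter> es ! i" using True by (auto simp: D_def)
      consider "i = 0" | "Suc i = g - 1" "i \<noteq> 0" | "0 < i" "i + 1 < length es"
        using \<open>i < g - 1\<close> len by linarith
      then show ?thesis
      proof cases
        case 1 then show ?thesis using Dij e0 True 2(1) by auto
      next
        case 2
        then have "i = g - 2" by simp
        then show ?thesis using Dij elast True 2 by auto
      next
        case 3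
        then have "e \<inter> es ! i = {}" using 2(8) by blast
        then show ?thesis using Dij True 3 len by auto
      qed
    next
      case False
      then have "j < length es" using ij len by simp
      then show ?thesis
        using hp(2)[of i] hp(3)[of i j] False ij by (auto simp: D_def c_def)
    qed
    show ?thesis
    proof (rule main[of c D])
      show "2 \<le> g" using 2(1) by simp
      show "inj_on c {..<g}" by (rule inj)
      show "D i \<in> edges G \<and> c i \<in> D i \<and> c (Suc i mod g) \<in> D i" if i: "i < g" for i
      proof (cases "i = g - 1")
        case True
        then have "Suc i mod g = 0" using 2(1) by simp
        then show ?thesis using True e0 elast 2(4) by (auto simp: D_def)
      next
        case False
        then have "i < length es" using i len by simp
        then show ?thesis using hp(1) False len by (auto simp: D_def c_def Defs.path_def)
      qed
      show "D i \<inter> D j \<subseteq> {c i, c (Suc i mod g)}" if ij: "i < g" "j < g" "i \<noteq> j" for i j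
      proof (cases "i < j")
        case True
        then show ?thesis using lt[of i j] ij by auto
      next
        case False
        then have "j < i" using ij by simp
        then have "D i \<inter> D j = (if i = Suc j then {c i} else if j = 0 \<and> i = g - 1 then {c 0} else {})"
          using lt[of j i] ij by (simp add: Int_commute)
        moreover have "Suc i mod g = 0" if "i = g - 1" using that ij by simp
        ultimately show ?thesis by auto
      qed
    qed
  qed
  show ?thesis
    using hc unfolding has_hypercycle_def
  proof
    assume "g = 2 \<and> (\<exists>e1\<in>edges G. \<exists>e2\<in>edges G. e1 \<noteq> e2 \<and> (\<exists>v1 v2. v1 \<noteq> v2 \<and> e1 \<inter> e2 = {v1, v2}))"
    then show ?thesis using two by meson
  next
    assume "3 \<le> g \<and> (\<exists>vs es e. hyperpath G vs es \<and> length vs = g \<and>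
        e \<in> edges G \<and> e \<notin> set es \<and>
        e \<inter> hd es = {hd vs} \<and> e \<inter> last es = {last vs} \<and>
        (\<forall>j. 0 < j \<and> j + 1 < length es \<longrightarrow> e \<inter> es ! j = {}))"
    then show ?thesis by (elim conjE exE) (rule long)
  qed
qed

lemma image_rotate_lessThan: "f ` {..<g} = (\<lambda>i. f ((i + s) mod g)) ` {..<g::nat}"
proof (cases "g = 0")
  case False
  show ?thesis
  proof (intro equalityI subsetI)
    fix y assume "y \<in> f ` {..<g}"
    then obtain i where i: "i < g" "y = f i" by auto
    have "((i + (g - s mod g)) mod g + s) mod g = (i + (g - s mod g) + s mod g) mod g"
      by (simp add: mod_simps)
    also have "i + (g - s mod g) + s mod g = i + g"
      using mod_less_divisor[of g s] False by linarith
    finally have "((i + (g - s mod g)) mod g + s) mod g = i" using i by simp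
    then show "y \<in> (\<lambda>i. f ((i + s) mod g)) ` {..<g}"
      using i False by (intro image_eqI[of _ _ "(i + (g - s mod g)) mod g"]) auto
  qed (use False in auto)
qed simp

text \<open>Renumbering lets any given vertex of the cycle be assumed to be \<open>c 0\<close> or to lie in \<open>I 0\<close>.\<close>

lemma loose_cycle_rotate:
  fixes c :: "nat \<Rightarrow> 'a"
  assumes cyc: "loose_cycle k g c I" and s: "s < g"
  obtains c' I' where "loose_cycle k g c' I'" "loose_cycle_verts g c' I' = loose_cycle_verts g c I"
    "loose_cycle_edge g c' I' ` {..<g} = loose_cycle_edge g c I ` {..<g}" "c' 0 = c s" "I' 0 = I s"
proof -
  define \<sigma> where "\<sigma> i = (i + s) mod g" for i
  have img: "f ` \<sigma> ` {..<g} = f ` {..<g}" for f :: "nat \<Rightarrow> 'b"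
    unfolding \<sigma>_def image_image by (rule image_rotate_lessThan[symmetric])
  have \<sigma>_img: "\<sigma> ` {..<g} = {..<g}" using img[of id] by simp
  then have inj: "inj_on \<sigma> {..<g}" by (intro eq_card_imp_inj_on) auto
  have lt: "\<sigma> i < g" for i using s by (simp add: \<sigma>_def)
  have "loose_cycle k g (c \<circ> \<sigma>) (I \<circ> \<sigma>)"
    using cyc inj lt unfolding loose_cycle_def disjoint_family_on_def
    by (auto simp: inj_on_eq_iff \<sigma>_img intro!: comp_inj_on)
  moreover have "loose_cycle_verts g (c \<circ> \<sigma>) (I \<circ> \<sigma>) = loose_cycle_verts g c I"
    using \<sigma>_img unfolding loose_cycle_verts_def by (metis image_comp)
  moreover have "loose_cycle_edge g (c \<circ> \<sigma>) (I \<circ> \<sigma>) ` {..<g} = loose_cycle_edge g c I ` {..<g}"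
  proof -
    have "loose_cycle_edge g (c \<circ> \<sigma>) (I \<circ> \<sigma>) = loose_cycle_edge g c I \<circ> \<sigma>"
      by (auto simp: loose_cycle_edge_def \<sigma>_def fun_eq_iff mod_simps)
    then show ?thesis using \<sigma>_img by (metis image_comp)
  qed
  moreover have "(c \<circ> \<sigma>) 0 = c s" "(I \<circ> \<sigma>) 0 = I s" using s by (auto simp: \<sigma>_def)
  ultimately show ?thesis by (rule that)
qed

lemma card_loose_cycle_verts:
  assumes cyc: "loose_cycle k g c I" and k: "3 \<le> k"
  shows "finite (loose_cycle_verts g c I)" "card (loose_cycle_verts g c I) = g * (k - 1)"
proof -
  have fI: "finite (I i)" if "i < g" for i
    using cyc that k by (metis card.infinite loose_cycle_def diff_is_0_eq not_less_eq_eq numeral_2_eq_2 numeral_3_eq_3)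
  then show "finite (loose_cycle_verts g c I)" by (auto simp: loose_cycle_verts_def)
  have "card (\<Union>i<g. I i) = (\<Sum>i<g. card (I i))"
    using cyc fI by (intro card_UN_disjoint) (auto simp: loose_cycle_def disjoint_family_on_def)
  also have "\<dots> = g * (k - 2)" using cyc by (simp add: loose_cycle_def)
  finally have "card (\<Union>i<g. I i) = g * (k - 2)" .
  moreover have "card (c ` {..<g}) = g" using cyc by (simp add: loose_cycle_def card_image)
  moreover have "c ` {..<g} \<inter> (\<Union>i<g. I i) = {}" using cyc by (auto simp: loose_cycle_def)
  ultimately have "card (loose_cycle_verts g c I) = g + g * (k - 2)"
    unfolding loose_cycle_verts_def using fI by (subst card_Un_disjoint) auto
  also have "\<dots> = g * Suc (k - 2)" by simp
  also have "Suc (k - 2) = k - 1" using k by simp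
  finally show "card (loose_cycle_verts g c I) = g * (k - 1)" .
qed

text \<open>For \<open>k \<ge> 3\<close> every edge has a vertex of its own, which tells it apart from the others.\<close>

lemma inj_on_loose_cycle_edge:
  assumes cyc: "loose_cycle k g c I" and k: "3 \<le> k"
  shows "inj_on (loose_cycle_edge g c I) {..<g}"
proof (rule inj_onI)
  fix i j assume ij: "i \<in> {..<g}" "j \<in> {..<g}" and eq: "loose_cycle_edge g c I i = loose_cycle_edge g c I j"
  have "card (I i) \<noteq> 0" using cyc ij k by (simp add: loose_cycle_def)
  then obtain z where z: "z \<in> I i" by (metis card.empty equals0I)
  then have "z \<in> loose_cycle_edge g c I j" using eq by (auto simp: loose_cycle_edge_def)
  moreover have "z \<noteq> c l" if "l < g" for l using cyc z ij that by (auto simp: loose_cycle_def)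
  ultimately have "z \<in> I j" using ij by (auto simp: loose_cycle_edge_def)
  then show "i = j" using z cyc ij by (auto simp: loose_cycle_def disjoint_family_on_def)
qed

text \<open>The effect on the cycle of moving its vertex \<open>r\<close> nearest to \<open>w\<close>. If \<open>r = c 0\<close>, then \<open>w\<close> takes its
  place in the edges number 0 and \<open>g - 1\<close>. If \<open>r\<close> is a private vertex of edge number 0, then \<open>w\<close> takes
  the place of \<open>r\<close> in that edge and the place of \<open>c 0\<close> in edge number \<open>g - 1\<close>; now \<open>w\<close> is the common
  vertex, and \<open>c 0\<close> has become a private vertex of edge number 0. The condition on \<open>w\<close> holds because
  the vertex of the cycle nearest to \<open>w\<close> is \<open>w\<close> itself if \<open>w\<close> lies on the cycle.\<close>

lemma loose_cycle_shift:
  assumes cyc: "loose_cycle k g c I" and g: "2 \<le> g" and k: "3 \<le> k"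
    and r: "r = c 0 \<or> r \<in> I 0" and w: "w \<in> loose_cycle_verts g c I \<Longrightarrow> w = r"
    and c'_def: "c' = c(0 := w)"
    and I'_def: "I' = (if r = c 0 then I else I(0 := insert (c 0) (I 0 - {r})))"
    and \<psi>_def: "\<psi> = (\<lambda>e. if r \<in> e then insert w (e - {r})
            else if c 0 \<in> e then insert w (e - {c 0}) else e)"
  shows "loose_cycle k g c' I'" and "loose_cycle_verts g c' I' = insert w (loose_cycle_verts g c I - {r})"
    and "\<And>i. i < g \<Longrightarrow> \<psi> (loose_cycle_edge g c I i) = loose_cycle_edge g c' I' i"
proof -
  have c_inj: "c i = c j \<longleftrightarrow> i = j" if "i < g" "j < g" for i j
    using cyc that by (auto simp: loose_cycle_def inj_on_eq_iff)
  have cI: "c j \<notin> I i" if "i < g" "j < g" for i j using cyc that by (auto simp: loose_cycle_def)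
  have I_disj: "I i \<inter> I j = {}" if "i < g" "j < g" "i \<noteq> j" for i j
    using cyc that by (auto simp: loose_cycle_def disjoint_family_on_def)
  have g0: "0 < g" using g by simp
  have w_c: "w \<noteq> c i" if "0 < i" "i < g" for i
  proof
    assume "w = c i"
    then have "r = c i" using w that by (auto simp: loose_cycle_verts_def)
    then show False using r c_inj[of i 0] cI[of 0 i] that by auto
  qed
  have w_I: "w \<notin> I' i" if i: "i < g" for i
  proof
    assume wI: "w \<in> I' i"
    show False
    proof (cases "r = c 0")
      case True
      then have "w \<in> I i" using wI by (simp add: I'_def)
      then show False using w i cI[OF i g0] True by (auto simp: loose_cycle_verts_def)
    next
      case False
      then have r0: "r \<in> I 0" using r by blast
      have "w \<noteq> c 0" using w False g0 by (auto simp: loose_cycle_verts_def)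
      then have "w \<in> I i" "i = 0 \<longrightarrow> w \<noteq> r" using wI False by (auto simp: I'_def split: if_splits)
      moreover from this have "w = r" using w i by (auto simp: loose_cycle_verts_def)
      ultimately show False using r0 I_disj[OF i g0] by (cases "i = 0") auto
    qed
  qed
  have c'_I': "c' j \<notin> I' i" if ij: "i < g" "j < g" for i j
  proof (cases "j = 0")
    case True
    then show ?thesis using w_I[OF ij(1)] by (simp add: c'_def)
  next
    case False
    then show ?thesis using cI ij c_inj[of j 0] g0 by (auto simp: c'_def I'_def)
  qed
  have "card (I' i) = k - 2" if "i < g" for i
  proof (cases "r = c 0 \<or> i \<noteq> 0")
    case True
    then show ?thesis using cyc that by (auto simp: I'_def loose_cycle_def)
  next
    case False
    then have r0: "r \<in> I 0" and i: "i = 0" and I': "I' 0 = insert (c 0) (I 0 - {r})"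
      using r by (auto simp: I'_def)
    have card: "card (I 0) = k - 2" using cyc g0 by (simp add: loose_cycle_def)
    then have fin: "finite (I 0)" using k by (intro card_ge_0_finite) simp
    have "card (I' 0) = Suc (card (I 0 - {r}))"
      unfolding I' using fin cI[OF g0 g0] by (intro card_insert_disjoint) auto
    also have "\<dots> = card (I 0)" by (rule card_Suc_Diff1[OF fin r0])
    finally show ?thesis using card i by simp
  qed
  moreover have "inj_on c' {..<g}"
    unfolding inj_on_def c'_def using c_inj w_c w_c[symmetric] by auto
  moreover have "disjoint_family_on I' {..<g}"
  proof -
    have "I' i \<inter> I' j = {}" if ij: "i < g" "j < g" "i \<noteq> j" for i j
      using I_disj[OF ij] cI[OF ij(1) g0] cI[OF ij(2) g0] ij(3) by (auto simp: I'_def)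
    then show ?thesis by (auto simp: disjoint_family_on_def)
  qed
  ultimately show "loose_cycle k g c' I'" using c'_I' by (auto simp: loose_cycle_def)
  have zero: "{..<g} = insert 0 {0<..<g}" using g0 by auto
  have c'_img: "c' ` {0<..<g} = c ` {0<..<g}" and I'_img: "(\<Union>i\<in>{0<..<g}. I' i) = (\<Union>i\<in>{0<..<g}. I i)"
    by (auto simp: c'_def I'_def)
  have r_c: "r \<noteq> c i" if "0 < i" "i < g" for i
    using r c_inj[of i 0] cI[of 0 i] that g0 by auto
  have r_I: "r \<notin> I i" if "0 < i" "i < g" for i
    using r cI[OF that(2) g0] I_disj[of 0 i] that g0 by auto
  have rest: "r \<notin> c ` {0<..<g}" "r \<notin> (\<Union>i\<in>{0<..<g}. I i)"
    using r_c r_I by (simp_all add: image_iff)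
  show "loose_cycle_verts g c' I' = insert w (loose_cycle_verts g c I - {r})"
  proof -
    define Z where "Z = c ` {0<..<g} \<union> (\<Union>i\<in>{0<..<g}. I i)"
    have split: "loose_cycle_verts g c I = insert (c 0) (I 0) \<union> Z"
      "loose_cycle_verts g c' I' = insert (c' 0) (I' 0) \<union> Z"
      unfolding loose_cycle_verts_def zero image_insert UN_insert Z_def by (simp_all add: Un_ac c'_img I'_img)
    have "insert (c' 0) (I' 0) = insert w (insert (c 0) (I 0) - {r})"
      using r cI[OF g0 g0] by (auto simp: c'_def I'_def)
    moreover have "r \<notin> Z" using rest by (simp add: Z_def)
    ultimately show ?thesis unfolding split by auto
  qed
  show "\<psi> (loose_cycle_edge g c I i) = loose_cycle_edge g c' I' i" if i: "i < g" for i
  proof -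
    have sg: "Suc i mod g < g" using g0 by simp
    have ne: "Suc i mod g \<noteq> i" using g i by (auto simp: mod_Suc)
    have c0: "c 0 \<in> loose_cycle_edge g c I i \<longleftrightarrow> i = 0 \<or> Suc i mod g = 0"
      using c_inj[OF g0 i] c_inj[OF g0 sg] cI[OF i g0] by (auto simp: loose_cycle_edge_def)
    show ?thesis
    proof (cases "r = c 0")
      case True
      consider "i = 0" | "i \<noteq> 0" "Suc i mod g = 0" | "i \<noteq> 0" "Suc i mod g \<noteq> 0" by blast
      then show ?thesis
        using c0 True cI[OF i g0] c_inj[OF g0 i] c_inj[OF g0 sg] ne
        by cases (auto simp: \<psi>_def c'_def I'_def loose_cycle_edge_def)
    next
      case False
      then have r0: "r \<in> I 0" using r by blast
      have rc: "r \<noteq> c j" if "j < g" for j using cI[OF g0 that] r0 by blast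
      have r_iff: "r \<in> loose_cycle_edge g c I i \<longleftrightarrow> i = 0"
        using rc[OF i] rc[OF sg] r0 I_disj[OF g0 i] by (auto simp: loose_cycle_edge_def)
      consider "i = 0" | "i \<noteq> 0" "Suc i mod g = 0" | "i \<noteq> 0" "Suc i mod g \<noteq> 0" by blast
      then show ?thesis
      proof cases
        case 1
        then show ?thesis using False r_iff rc[OF g0] rc[OF sg] ne
          by (auto simp: \<psi>_def c'_def I'_def loose_cycle_edge_def)
      next
        case 2
        then show ?thesis using False r_iff c0 cI[OF i g0] c_inj[OF g0 i]
          by (auto simp: \<psi>_def c'_def I'_def loose_cycle_edge_def)
      next
        case 3
        then show ?thesis using False r_iff c0
          by (auto simp: \<psi>_def c'_def I'_def loose_cycle_edge_def)
      qed
    qed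
  qed
qed

section \<open>Recognizing the extremal hypergraph\<close>

lemma verts_U_star:
  "verts (U_star n k g) = {Cyc i |i. i < g} \<union> {Inner i j |i j. i < g \<and> j < k - 2} \<union>
     {Pend i j |i j. i < n div (k - 1) - g \<and> j < k - 1}"
  by (simp add: U_star_def hypercycle_graph_def Let_def)

lemma edges_U_star:
  "edges (U_star n k g) =
     (\<lambda>i. {Cyc i, Cyc (Suc i mod g)} \<union> Inner i ` {..<k - 2}) ` {..<g} \<union>
     (\<lambda>i. insert (Cyc 0) (Pend i ` {..<k - 1})) ` {..<n div (k - 1) - g}"
  by (simp add: U_star_def hypercycle_graph_def Let_def setcompr_eq_image lessThan_def)

lemma edges_U_star_subset:
  assumes "e \<in> edges (U_star n k g)" "0 < g"
  shows "e \<subseteq> verts (U_star n k g)"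
  using assms unfolding verts_U_star edges_U_star by auto

lemma card_edges_U_star:
  assumes k: "3 \<le> k"
  shows "card (edges (U_star n k g)) = g + (n div (k - 1) - g)"
proof -
  let ?p = "n div (k - 1) - g"
  let ?r = "\<lambda>i. {Cyc i, Cyc (Suc i mod g)} \<union> Inner i ` {..<k - 2}"
  let ?q = "\<lambda>i. insert (Cyc 0) (Pend i ` {..<k - 1})"
  have r: "Inner j 0 \<in> ?r i \<longleftrightarrow> i = j" for i j using k by auto
  have q: "Pend j 0 \<in> ?q i \<longleftrightarrow> i = j" for i j using k by auto
  have "inj_on ?r {..<g}" by (rule inj_onI) (metis r)
  moreover have "inj_on ?q {..<?p}" by (rule inj_onI) (metis q)
  moreover have "?r i \<noteq> ?q j" for i j
  proof -
    have "Inner i 0 \<in> ?r i" using r by blast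
    moreover have "Inner i 0 \<notin> ?q j" by auto
    ultimately show ?thesis by metis
  qed
  then have "?r ` {..<g} \<inter> ?q ` {..<?p} = {}" by blast
  ultimately show ?thesis
    unfolding edges_U_star by (simp add: card_Un_disjoint card_image)
qed

lemma U_star_iso_if_loose_cycle_with_pendants:
  fixes H :: "'a hypergraph"
  assumes k: "3 \<le> k" and g: "2 \<le> g" and cyc: "loose_cycle k g c I" and p: "p = n div (k - 1) - g"
    and P: "\<And>i. i < p \<Longrightarrow> finite (P i) \<and> card (P i) = k - 1 \<and> P i \<inter> loose_cycle_verts g c I = {}"
    and disj: "disjoint_family_on P {..<p}"
    and V: "verts H = loose_cycle_verts g c I \<union> (\<Union>i<p. P i)"
    and E: "edges H = loose_cycle_edge g c I ` {..<g} \<union> (\<lambda>i. insert (c 0) (P i)) ` {..<p}"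
  shows "U_star n k g \<cong>\<^sub>H H"
proof -
  let ?U = "U_star n k g"
  have "\<exists>h. bij_betw h {..<k - 2} (I i)" if "i < g" for i
  proof -
    have card: "card (I i) = k - 2" using cyc that by (simp add: loose_cycle_def)
    then have "finite (I i)" using k by (intro card_ge_0_finite) simp
    then show ?thesis using card by (intro finite_same_card_bij) auto
  qed
  then obtain \<iota> where \<iota>: "\<And>i. i < g \<Longrightarrow> bij_betw (\<iota> i) {..<k - 2} (I i)" by metis
  have "\<exists>h. bij_betw h {..<k - 1} (P i)" if "i < p" for i
    using P[OF that] by (intro finite_same_card_bij) auto
  then obtain \<pi> where \<pi>: "\<And>i. i < p \<Longrightarrow> bij_betw (\<pi> i) {..<k - 1} (P i)" by metis
  define f where "f x = (case x of Cyc i \<Rightarrow> c i | Inner i j \<Rightarrow> \<iota> i j | Pend i j \<Rightarrow> \<pi> i j)" for x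
  have \<iota>_img: "\<iota> i ` {..<k - 2} = I i" if "i < g" for i using \<iota>[OF that] by (simp add: bij_betw_def)
  have \<pi>_img: "\<pi> i ` {..<k - 1} = P i" if "i < p" for i using \<pi>[OF that] by (simp add: bij_betw_def)
  have \<iota>_mem: "\<iota> i j \<in> I i" if "i < g" "j < k - 2" for i j using \<iota>_img[OF that(1)] that by blast
  have \<pi>_mem: "\<pi> i j \<in> P i" if "i < p" "j < k - 1" for i j using \<pi>_img[OF that(1)] that by blast
  have c_inj: "c i = c j \<longleftrightarrow> i = j" if "i < g" "j < g" for i j
    using cyc that by (auto simp: loose_cycle_def inj_on_eq_iff)
  have \<iota>_inj: "\<iota> i j = \<iota> i' j' \<longleftrightarrow> i = i' \<and> j = j'"
    if "i < g" "i' < g" "j < k - 2" "j' < k - 2" for i i' j j'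
  proof (cases "i = i'")
    case True
    then show ?thesis using \<iota>[OF that(1)] that by (auto simp: bij_betw_def inj_on_eq_iff)
  next
    case False
    then have "I i \<inter> I i' = {}" using cyc that by (simp add: loose_cycle_def disjoint_family_on_def)
    then show ?thesis using False \<iota>_mem that by (metis disjoint_iff)
  qed
  have \<pi>_inj: "\<pi> i j = \<pi> i' j' \<longleftrightarrow> i = i' \<and> j = j'"
    if "i < p" "i' < p" "j < k - 1" "j' < k - 1" for i i' j j'
  proof (cases "i = i'")
    case True
    then show ?thesis using \<pi>[OF that(1)] that by (auto simp: bij_betw_def inj_on_eq_iff)
  next
    case False
    then have "P i \<inter> P i' = {}" using disj that by (simp add: disjoint_family_on_def)
    then show ?thesis using False \<pi>_mem that by (metis disjoint_iff)
  qed
  have c\<iota>: "c l \<noteq> \<iota> i j" if "l < g" "i < g" "j < k - 2" for l i j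
    using cyc \<iota>_mem[OF that(2,3)] that unfolding loose_cycle_def by metis
  have cyc\<pi>: "v \<noteq> \<pi> i j" if "v \<in> loose_cycle_verts g c I" "i < p" "j < k - 1" for v i j
    using P[OF that(2)] \<pi>_mem[OF that(2,3)] that(1) by auto
  have c\<pi>: "c l \<noteq> \<pi> i j" if "l < g" "i < p" "j < k - 1" for l i j
    using that by (intro cyc\<pi>) (auto simp: loose_cycle_verts_def)
  have \<iota>\<pi>: "\<iota> i' j' \<noteq> \<pi> i j" if "i' < g" "j' < k - 2" "i < p" "j < k - 1" for i' j' i j
    using that \<iota>_mem by (intro cyc\<pi>) (auto simp: loose_cycle_verts_def)
  have inj: "inj_on f (verts ?U)"
    unfolding verts_U_star p[symmetric] inj_on_def
    by (auto simp: f_def c_inj \<iota>_inj \<pi>_inj c\<iota> c\<iota>[symmetric] c\<pi> c\<pi>[symmetric] \<iota>\<pi> \<iota>\<pi>[symmetric])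
  have VU: "verts ?U = Cyc ` {..<g} \<union> (\<Union>i<g. Inner i ` {..<k - 2}) \<union> (\<Union>i<p. Pend i ` {..<k - 1})"
    unfolding verts_U_star p[symmetric] by auto
  have f_img: "f ` Cyc ` A = c ` A" "f ` Inner i ` B = \<iota> i ` B" "f ` Pend i ` B = \<pi> i ` B" for A B i
    by (auto simp: f_def image_image)
  have "f ` verts ?U = verts H"
    unfolding VU V loose_cycle_verts_def image_Un image_UN f_img
    using \<iota>_img \<pi>_img by simp
  then have bij: "bij_betw f (verts ?U) (verts H)" using inj by (simp add: bij_betw_def)
  have sub: "edges ?U \<subseteq> Pow (verts ?U)" using edges_U_star_subset g by fastforce
  have "(\<lambda>e. f ` e) ` edges ?U = edges H"
  proof -
    have "f ` ({Cyc i, Cyc (Suc i mod g)} \<union> Inner i ` {..<k - 2}) = loose_cycle_edge g c I i" if "i < g" for i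
      using \<iota>_img[OF that] unfolding image_Un f_img loose_cycle_edge_def by (simp add: f_def)
    moreover have "f ` insert (Cyc 0) (Pend i ` {..<k - 1}) = insert (c 0) (P i)" if "i < p" for i
      using \<pi>_img[OF that] unfolding image_insert f_img by (simp add: f_def)
    ultimately show ?thesis
      unfolding edges_U_star E p[symmetric] image_Un image_image
      by (intro arg_cong2[where f = "(\<union>)"] image_cong) auto
  qed
  moreover have "inj_on (\<lambda>e. f ` e) (edges ?U)"
    using inj_on_image_Pow[OF inj] sub by (rule inj_on_subset)
  ultimately show ?thesis using bij unfolding hypergraph_iso_def bij_betw_def by blast
qed

lemma hypergraph_iso_is_hypergraph:
  assumes H: "is_hypergraph H" and iso: "U \<cong>\<^sub>H H" and sub: "\<And>e. e \<in> edges U \<Longrightarrow> e \<subseteq> verts U"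
  shows "is_hypergraph U"
proof -
  obtain f where f: "bij_betw f (verts U) (verts H)" and fe: "bij_betw (\<lambda>e. f ` e) (edges U) (edges H)"
    using iso unfolding hypergraph_iso_def by blast
  have "2 \<le> card e" if e: "e \<in> edges U" for e
  proof -
    have "f ` e \<in> edges H" using fe e by (auto simp: bij_betw_def)
    then have "2 \<le> card (f ` e)" using H by (simp add: is_hypergraph_def)
    moreover have "card (f ` e) = card e"
      using f sub[OF e] by (intro card_image) (auto simp: bij_betw_def intro: inj_on_subset)
    ultimately show ?thesis by simp
  qed
  moreover have "finite (verts U)" "verts U \<noteq> {}"
    using H bij_betw_finite[OF f] f by (auto simp: is_hypergraph_def bij_betw_def)
  ultimately show ?thesis using sub by (simp add: is_hypergraph_def)
qed

section \<open>Moving all edges to one vertex\<close>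

text \<open>The edge moves described at the beginning. Edges are never identified by the moves: this is
  obtained at the end from the isomorphism, because the extremal hypergraph has as many edges as
  \<open>G\<close>.\<close>

lemma concentrate_at_vertex:
  fixes G :: "'a hypergraph"
  assumes k: "3 \<le> k" and uni: "unicyclic k G" and hc: "has_hypercycle G g" and w: "w \<in> verts G"
  obtains \<phi> where "inj_on \<phi> (edges G)"
    and "\<And>e. e \<in> edges G \<Longrightarrow> \<phi> e = e \<or> (\<exists>a\<in>e. w \<notin> e \<and> \<phi> e = insert w (e - {a}))"
    and "U_star (card (verts G)) k g \<cong>\<^sub>H \<lparr>verts = verts G, edges = \<phi> ` edges G\<rparr>"
    and "2 \<le> g"
proof -
  let ?V = "verts G" and ?E = "edges G"
  have G: "is_hypergraph G" and unif: "uniform k G" and conn: "connected_hypergraph G"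
    and n: "card ?V = (k - 1) * card ?E"
    using uni by (auto simp: unicyclic_def)
  have fin: "finite ?V" and sub: "\<And>e. e \<in> ?E \<Longrightarrow> e \<subseteq> ?V" using G by (auto simp: is_hypergraph_def)
  have ce: "card e = k" if "e \<in> ?E" for e using unif that by (simp add: uniform_def)
  have finE: "finite ?E" by (rule finite_edges[OF G])
  obtain c\<^sub>0 I\<^sub>0 where g: "2 \<le> g" and cyc0: "loose_cycle k g c\<^sub>0 I\<^sub>0"
    and edge0: "\<And>i. i < g \<Longrightarrow> loose_cycle_edge g c\<^sub>0 I\<^sub>0 i \<in> ?E"
    using hypercycle_imp_loose_cycle[OF G unif hc] by blast
  define C where "C = loose_cycle_verts g c\<^sub>0 I\<^sub>0"
  define EC where "EC = loose_cycle_edge g c\<^sub>0 I\<^sub>0 ` {..<g}"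
  have EC: "EC \<subseteq> ?E" using edge0 by (auto simp: EC_def)
  have cardEC: "card EC = g" unfolding EC_def using inj_on_loose_cycle_edge[OF cyc0 k] by (simp add: card_image)
  have gm: "g \<le> card ?E" using card_mono[OF finE EC] cardEC by simp
  have finC: "finite C" and cardC: "card C = g * (k - 1)"
    using card_loose_cycle_verts[OF cyc0 k] by (auto simp: C_def)
  have EC_C: "\<Union>EC = C"
  proof
    have "Suc i mod g < g" for i using g by simp
    then show "\<Union>EC \<subseteq> C" by (auto simp: EC_def C_def loose_cycle_edge_def loose_cycle_verts_def)
    show "C \<subseteq> \<Union>EC" by (auto simp: EC_def C_def loose_cycle_edge_def loose_cycle_verts_def)
  qed
  \<comment> \<open>The vertex set \<open>C\<close> of the hypercycle replaces its edges; being larger than an edge of \<open>G\<close>, it is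
     a new member of the family and is counted separately.\<close>
  define F where "F = insert C (?E - EC)"
  have "C \<notin> ?E"
  proof
    assume "C \<in> ?E"
    then have "k = g * (k - 1)" using ce cardC by metis
    moreover have "2 * (k - 1) \<le> g * (k - 1)" using g by simp
    ultimately show False using k by simp
  qed
  then have CF: "C \<notin> ?E - EC" by blast
  have finF: "finite F" using finE by (simp add: F_def)
  have CV: "C \<subseteq> ?V" using EC_C EC sub by blast
  have F: "e \<subseteq> ?V \<and> e \<noteq> {}" if "e \<in> F" for e
  proof -
    have "C \<noteq> {}" using cardC g k by auto
    moreover have "e \<noteq> {}" if "e \<in> ?E" using ce[OF that] k by auto
    ultimately show ?thesis using that CV sub by (auto simp: F_def)
  qed
  have "share_edge ?E \<subseteq> share_edge F"
    unfolding share_edge_def F_def using EC_C by blast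
  then have connF: "(w, u) \<in> (share_edge F)\<^sup>*" if "u \<in> ?V" for u
    using connected_imp_share_edge_rtrancl[OF conn w that] rtrancl_mono by blast
  have count: "(\<Sum>e\<in>F. card e - 1) = card ?V - 1"
  proof -
    have "(\<Sum>e\<in>?E - EC. card e - 1) = (card ?E - g) * (k - 1)"
      using ce card_Diff_subset[of EC ?E] EC finE cardEC by (simp add: finite_subset)
    then have "(\<Sum>e\<in>F. card e - 1) = (g * (k - 1) - 1) + (card ?E - g) * (k - 1)"
      unfolding F_def using CF finE cardC by simp
    moreover have "(k - 1) * card ?E = g * (k - 1) + (card ?E - g) * (k - 1)"
      using gm by (metis add_mult_distrib le_add_diff_inverse mult.commute)
    moreover have "1 \<le> g * (k - 1)" using g k by simp
    ultimately show ?thesis using n by simp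
  qed
  obtain p where p: "\<And>e. e \<in> F \<Longrightarrow> p e \<in> e" and pw: "\<And>e. e \<in> F \<Longrightarrow> w \<in> e \<Longrightarrow> p e = w"
    and pdisj: "\<And>e f. e \<in> F \<Longrightarrow> f \<in> F \<Longrightarrow> e \<noteq> f \<Longrightarrow> (e - {p e}) \<inter> (f - {p f}) = {}"
    and pcover: "(\<Union>e\<in>F. e - {p e}) = ?V - {w}"
    using rooted_edge_partition[OF fin w finF F connF count] by blast
  have CF: "C \<in> F" by (simp add: F_def)
  define r where "r = p C"
  have rC: "r \<in> C" and rw: "w \<in> C \<Longrightarrow> w = r" using p[OF CF] pw[OF CF] by (auto simp: r_def)
  obtain s where s: "s < g" "r = c\<^sub>0 s \<or> r \<in> I\<^sub>0 s" using rC by (auto simp: C_def loose_cycle_verts_def)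
  obtain c I where cyc: "loose_cycle k g c I" and C: "loose_cycle_verts g c I = C"
    and EC_eq: "loose_cycle_edge g c I ` {..<g} = EC" and cs: "c 0 = c\<^sub>0 s" "I 0 = I\<^sub>0 s"
    using loose_cycle_rotate[OF cyc0 s(1)] unfolding C_def EC_def by metis
  define c' where "c' = c(0 := w)"
  define I' where "I' = (if r = c 0 then I else I(0 := insert (c 0) (I 0 - {r})))"
  define \<psi> where "\<psi> e = (if r \<in> e then insert w (e - {r})
      else if c 0 \<in> e then insert w (e - {c 0}) else e)" for e
  have r: "r = c 0 \<or> r \<in> I 0" using s cs by simp
  note shifted = loose_cycle_shift[OF cyc g k r rw[folded C] c'_def I'_def \<psi>_def[THEN ext]]
  define \<phi> where "\<phi> e = (if e \<in> EC then \<psi> e else insert w (e - {p e}))" for e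
  have shift: "\<phi> e = e \<or> (\<exists>a\<in>e. w \<notin> e \<and> \<phi> e = insert w (e - {a}))" if e: "e \<in> ?E" for e
  proof (cases "e \<in> EC")
    case True
    have "w \<in> e \<Longrightarrow> w = r" using rw True EC_C by blast
    then show ?thesis using True by (cases "w \<in> e") (auto simp: \<phi>_def \<psi>_def)
  next
    case False
    then have "e \<in> F" using e by (simp add: F_def)
    then show ?thesis using False p[of e] pw[of e] by (cases "w \<in> e") (auto simp: \<phi>_def)
  qed
  define q where "q = card ?E - g"
  have cardT: "card (?E - EC) = q"
    unfolding q_def using card_Diff_subset[of EC ?E] EC finE cardEC by (simp add: finite_subset)
  obtain t where t: "bij_betw t {..<q} (?E - EC)"
    using finite_same_card_bij[of "{..<q}" "?E - EC"] finE cardT by auto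
  define P where "P i = t i - {p (t i)}" for i
  have tF: "t i \<in> ?E" "t i \<in> F" "t i \<noteq> C" if "i < q" for i
    using t that CF \<open>C \<notin> ?E\<close> by (auto simp: bij_betw_def F_def)
  have t_img: "t ` {..<q} = ?E - EC" using t by (simp add: bij_betw_def)
  have VC: "loose_cycle_verts g c' I' = insert w (C - {r})" using shifted(2) C by simp
  have qn: "q = card ?V div (k - 1) - g" using n k by (simp add: q_def)
  let ?H = "\<lparr>verts = ?V, edges = \<phi> ` ?E\<rparr>"
  have iso: "U_star (card ?V) k g \<cong>\<^sub>H ?H"
  proof (rule U_star_iso_if_loose_cycle_with_pendants[OF k g shifted(1) qn])
    show "finite (P i) \<and> card (P i) = k - 1 \<and> P i \<inter> loose_cycle_verts g c' I' = {}" if i: "i < q" for i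
    proof (intro conjI)
      have fi: "finite (t i)" using sub[OF tF(1)[OF i]] fin finite_subset by blast
      then show "finite (P i)" by (simp add: P_def)
      show "card (P i) = k - 1" using p[OF tF(2)[OF i]] ce[OF tF(1)[OF i]] by (simp add: P_def)
      have "P i \<inter> (C - {r}) = {}"
        using pdisj[OF tF(2)[OF i] CF tF(3)[OF i]] by (simp add: P_def r_def)
      moreover have "w \<notin> P i" using pw[OF tF(2)[OF i]] by (auto simp: P_def)
      ultimately show "P i \<inter> loose_cycle_verts g c' I' = {}" unfolding VC by blast
    qed
    show "disjoint_family_on P {..<q}"
      unfolding disjoint_family_on_def
    proof (intro ballI impI)
      fix i j assume "i \<in> {..<q}" "j \<in> {..<q}" "i \<noteq> j"
      moreover from this have "t i \<noteq> t j" using t by (auto simp: bij_betw_def inj_on_eq_iff)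
      ultimately show "P i \<inter> P j = {}" unfolding P_def using pdisj tF(2) by simp
    qed
    have "(\<Union>i<q. P i) = (\<Union>e\<in>t ` {..<q}. e - {p e})" by (simp add: P_def)
    then have "(C - {r}) \<union> (\<Union>i<q. P i) = ?V - {w}"
      using pcover unfolding t_img F_def r_def by simp
    then show "verts ?H = loose_cycle_verts g c' I' \<union> (\<Union>i<q. P i)" unfolding VC using w by auto
    have "\<phi> ` ?E = \<phi> ` EC \<union> \<phi> ` (?E - EC)" using EC by blast
    also have "\<phi> ` EC = \<psi> ` EC" by (auto simp: \<phi>_def)
    also have "\<psi> ` EC = loose_cycle_edge g c' I' ` {..<g}"
      unfolding EC_eq[symmetric] image_image using shifted(3) by (intro image_cong) auto
    also have "\<phi> ` (?E - EC) = (\<lambda>i. insert (c' 0) (P i)) ` {..<q}"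
    proof -
      have "\<phi> ` (?E - EC) = (\<lambda>e. insert w (e - {p e})) ` (?E - EC)" by (auto simp: \<phi>_def)
      also have "\<dots> = (\<lambda>i. insert w (t i - {p (t i)})) ` {..<q}"
        unfolding t_img[symmetric] image_image ..
      finally show ?thesis by (simp add: P_def c'_def)
    qed
    finally show "edges ?H = loose_cycle_edge g c' I' ` {..<g} \<union> (\<lambda>i. insert (c' 0) (P i)) ` {..<q}"
      by simp
  qed
  have "card (edges (U_star (card ?V) k g)) = card (\<phi> ` ?E)"
    using iso unfolding hypergraph_iso_def by (auto dest!: bij_betw_same_card)
  then have "card (\<phi> ` ?E) = card ?E" using card_edges_U_star[OF k] qn gm by (simp add: q_def)
  then have "inj_on \<phi> ?E" using finE by (intro eq_card_imp_inj_on)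
  then show ?thesis using shift iso g by (rule that)
qed

theorem theorem1p3:
  fixes G :: "'a hypergraph" and k n g :: nat
  assumes "3 \<le> k"
    and "unicyclic k G"
    and "card (verts G) = n"
    and "girth G = enat g"
  shows "\<rho> G \<le> \<rho> (U_star n k g) \<and>
    (\<rho> G = \<rho> (U_star n k g) \<longleftrightarrow> G \<cong>\<^sub>H U_star n k g)"
proof -
  let ?U = "U_star n k g"
  have G: "is_hypergraph G" and unif: "uniform k G" and conn: "connected_hypergraph G"
    using assms(2) by (auto simp: unicyclic_def)
  have fin: "finite (verts G)" and ne: "verts G \<noteq> {}" and sub: "\<And>e. e \<in> edges G \<Longrightarrow> e \<subseteq> verts G"
    using G by (auto simp: is_hypergraph_def)
  have hc: "has_hypercycle G g"
  proof -
    let ?Q = "enat ` {q. has_hypercycle G q}"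
    have inf: "Inf ?Q = enat g" using assms(4) by (simp add: girth_def)
    then have "?Q \<noteq> {}" by (auto simp: Inf_enat_def split: if_splits)
    then have "Inf ?Q \<in> ?Q"
      unfolding Inf_enat_def by (simp only: if_False) (rule LeastI_ex, blast)
    then show ?thesis unfolding inf by auto
  qed
  obtain x where pos: "\<And>i. i \<in> verts G \<Longrightarrow> 0 < x i"
    and ev: "\<And>i. i \<in> verts G \<Longrightarrow> (\<Sum>j\<in>verts G. adj G i j * x j) = \<rho> G * x i"
    and q: "quad_form (verts G) (adj G) x = \<rho> G * (\<Sum>i\<in>verts G. (x i)\<^sup>2)"
    using perron_vector[OF G conn] by blast
  obtain w where w: "w \<in> verts G" "\<And>v. v \<in> verts G \<Longrightarrow> x v \<le> x w"
  proof -
    have "Max (x ` verts G) \<in> x ` verts G" using fin ne by simp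
    then obtain w where "w \<in> verts G" "x w = Max (x ` verts G)" by auto
    then show ?thesis using that fin by simp
  qed
  obtain \<phi> where inj: "inj_on \<phi> (edges G)"
    and shift: "\<And>e. e \<in> edges G \<Longrightarrow> \<phi> e = e \<or> (\<exists>a\<in>e. w \<notin> e \<and> \<phi> e = insert w (e - {a}))"
    and iso': "U_star (card (verts G)) k g \<cong>\<^sub>H \<lparr>verts = verts G, edges = \<phi> ` edges G\<rparr>"
    and g: "2 \<le> g"
    using concentrate_at_vertex[OF assms(1,2) hc w(1)] by blast
  define H where "H = \<lparr>verts = verts G, edges = \<phi> ` edges G\<rparr>"
  have iso: "?U \<cong>\<^sub>H H" using iso' assms(3) by (simp add: H_def)
  have H: "verts H = verts G" "edges H = \<phi> ` edges G" by (auto simp: H_def)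
  have k2: "2 \<le> k" using assms(1) by simp
  note main = edge_shift_spectral_radius[OF G unif k2 pos ev q w H inj shift]
  have hypH: "is_hypergraph H" by (rule main(1))
  have subU: "e \<subseteq> verts ?U" if "e \<in> edges ?U" for e using edges_U_star_subset[OF that] g by simp
  have U: "is_hypergraph ?U" by (rule hypergraph_iso_is_hypergraph[OF hypH iso subU])
  have HU: "H \<cong>\<^sub>H ?U" by (rule hypergraph_iso_sym[OF iso subU])
  have rho: "\<rho> H = \<rho> ?U"
    using hypergraph_iso_spectral_radius_le[OF U hypH iso]
      hypergraph_iso_spectral_radius_le[OF hypH U HU] by simp
  show ?thesis
  proof (intro conjI iffI)
    show "\<rho> G \<le> \<rho> ?U" using main(2) rho by simp
    show "G \<cong>\<^sub>H ?U" if "\<rho> G = \<rho> ?U" using main(3) that rho HU by simp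
    show "\<rho> G = \<rho> ?U" if iso_G: "G \<cong>\<^sub>H ?U"
      using hypergraph_iso_spectral_radius_le[OF G U iso_G]
        hypergraph_iso_spectral_radius_le[OF U G hypergraph_iso_sym[OF iso_G sub]] by simp
  qed
qed

end
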